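(* Let $p,q\in\mathbb{N}$, let $\alpha_1\in(0,1)$, $\alpha_2=1-\alpha_1$, let $\mathbf{A}\in\mathbb{R}^{p\times p}$ and $\mathbf{B}\in\mathbb{R}^{q\times q}$ be symmetric positive definite, let $\mathbf{T}_1\neq\mathbf{T}_2$ be matrices in $\mathbb{R}^{p\times q}$, and let the random $p\times q$ matrix $\mathbf{X}$ satisfy $$\mathbf{X}\sim\alpha_1\mathcal{N}_{p\times q}(\mathbf{T}_1,\mathbf{A},\mathbf{B})+\alpha_2\mathcal{N}_{p\times q}(\mathbf{T}_2,\mathbf{A},\mathbf{B}).$$ Let $d=\mathrm{rank}(\mathbf{T}_2-\mathbf{T}_1)$ and $\mathbf{W}_{\mathrm{LDA}}=\mathbf{A}^{-1}(\mathbf{T}_2-\mathbf{T}_1)\mathbf{B}^{-1}$. Assume that the non-zero singular values of $\mathbf{A}^{-1/2}(\mathbf{T}_2-\mathbf{T}_1)\mathbf{B}^{-1/2}$ are distinct. Then: (i) If $|\alpha_1-1/2|<1/\sqrt{12}$ and $\alpha_1\neq 1/2$, then any sequence $(\mathbf{u}_1,\mathbf{v}_1),\ldots,(\mathbf{u}_d,\mathbf{v}_d)$ of $(\mathcal{G}_{1,\mathbf{X}},\mathcal{G}_{2,\mathbf{X}})$-minimizers of $(\psi_{\mathbf{X}},\psi_{\mathbf{X}'})$ satisfies $$\sum_{j=1}^d\frac{s_j\lambda_j\sqrt{1+\alpha_1\alpha_2\lambda_j^2}}{\sqrt{\mathrm{E}([\mathbf{u}_j'\{\mathbf{X}-\mathrm{E}(\mathbf{X})\}\mathbf{v}_j]^2)}}\,\mathbf{u}_j\mathbf{v}_j'=\mathbf{W}_{\mathrm{LDA}},$$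 where $s_1,\ldots,s_d\in\{-1,1\}$ are the signs of the quantities $(\alpha_1-\alpha_2)^{-1}\mathrm{E}([\mathbf{u}_j'\{\mathbf{X}-\mathrm{E}(\mathbf{X})\}\mathbf{v}_j]^3)$. (ii) If $|\alpha_1-1/2|=1/\sqrt{12}$, then $\psi_{\mathbf{X}}(\mathbf{u})=q(q+2)$ for all $\mathbf{u}\in\mathbb{S}^{p-1}$ and $\psi_{\mathbf{X}'}(\mathbf{v})=p(p+2)$ for all $\mathbf{v}\in\mathbb{S}^{q-1}$. (iii) If $|\alpha_1-1/2|>1/\sqrt{12}$, then any sequence $(\mathbf{u}_1,\mathbf{v}_1),\ldots,(\mathbf{u}_d,\mathbf{v}_d)$ of $(\mathcal{G}_{1,\mathbf{X}},\mathcal{G}_{2,\mathbf{X}})$-maximizers of $(\psi_{\mathbf{X}},\psi_{\mathbf{X}'})$ satisfies $$\sum_{j=1}^d\frac{s_j\lambda_j\sqrt{1+\alpha_1\alpha_2\lambda_j^2}}{\sqrt{\mathrm{E}([\mathbf{u}_j'\{\mathbf{X}-\mathrm{E}(\mathbf{X})\}\mathbf{v}_j]^2)}}\,\mathbf{u}_j\mathbf{v}_j'=\mathbf{W}_{\mathrm{LDA}},$$ where $s_1,\ldots,s_d\in\{-1,1\}$ are the signs of the quantities $(\alpha_1-\alpha_2)^{-1}\mathrm{E}([\mathbf{u}_j'\{\mathbf{X}-\mathrm{E}(\mathbf{X})\}\mathbf{v}_j]^3)$.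
   Context: Prime denotes transpose, $\mathbb{S}^{p-1}$ is the unit sphere of $\mathbb{R}^p$, and $\mathcal{U}_0:=\mathbb{S}^{p-1}\times\mathbb{S}^{q-1}$. $\mathcal{N}_{p\times q}(\mathbf{T},\mathbf{A},\mathbf{B})$ is the distribution of $\mathbf{T}+\mathbf{A}^{1/2}\mathbf{Z}\mathbf{B}^{1/2}$, where the entries of the $p\times q$ random matrix $\mathbf{Z}$ are i.i.d. standard normal and square roots are the symmetric positive definite ones; $\alpha_1 P_1+\alpha_2 P_2$ denotes the mixture distribution. Indices: with $\tilde{\mathbf{X}}:=\mathbf{X}-\mathrm{E}(\mathbf{X})$, for $\mathbf{u}\in\mathbb{S}^{p-1}$ and $\mathbf{v}\in\mathbb{S}^{q-1}$, $$\psi_{\mathbf{X}}(\mathbf{u}):=\mathrm{E}\left[\left\{\mathbf{u}'\tilde{\mathbf{X}}[\mathrm{E}(\tilde{\mathbf{X}}'\mathbf{u}\mathbf{u}'\tilde{\mathbf{X}})]^{-1}\tilde{\mathbf{X}}'\mathbf{u}\right\}^2\right],\qquad \psi_{\mathbf{X}'}(\mathbf{v}):=\mathrm{E}\left[\left\{\mathbf{v}'\tilde{\mathbf{X}}'[\mathrm{E}(\tilde{\mathbf{X}}\mathbf{v}\mathbf{v}'\tilde{\mathbf{X}}')]^{-1}\tilde{\mathbf{X}}\mathbf{v}\right\}^2\right].$$ Sequences of optimizers: for pairs $(\mathbf{u}_1,\mathbf{v}_1),\ldots,(\mathbf{u}_d,\mathbf{v}_d)\in\mathcal{U}_0$, put,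 for $k=1,\ldots,d-1$, $\mathbf{G}_{1k,\mathbf{X}}:=\mathrm{E}[\tilde{\mathbf{X}}\mathbf{v}_k\mathbf{v}_k'\tilde{\mathbf{X}}']$ and $\mathbf{G}_{2k,\mathbf{X}}:=\mathrm{E}[\tilde{\mathbf{X}}'\mathbf{u}_k\mathbf{u}_k'\tilde{\mathbf{X}}]$, and $\mathcal{G}_{i,\mathbf{X}}=\{\mathbf{G}_{i1,\mathbf{X}},\ldots,\mathbf{G}_{i(d-1),\mathbf{X}}\}$, $i=1,2$. The pairs form a sequence of $(\mathcal{G}_{1,\mathbf{X}},\mathcal{G}_{2,\mathbf{X}})$-minimizers (maximizers) of a pair of functions $(g_1,g_2)$, $g_1:\mathbb{S}^{p-1}\to\mathbb{R}$, $g_2:\mathbb{S}^{q-1}\to\mathbb{R}$, if $\mathbf{u}_1$ minimizes (maximizes) $g_1$ in $\mathbb{S}^{p-1}$, $\mathbf{v}_1$ minimizes (maximizes) $g_2$ in $\mathbb{S}^{q-1}$, and, for each $j=2,\ldots,d$, $\mathbf{u}_j$ minimizes (maximizes) $g_1$ over those $\mathbf{u}\in\mathbb{S}^{p-1}$ with $\mathbf{u}'\mathbf{G}_{1k,\mathbf{X}}\mathbf{u}_k=0$ for all $k=1,\ldots,j-1$, and $\mathbf{v}_j$ minimizes (maximizes) $g_2$ over those $\mathbf{v}\in\mathbb{S}^{q-1}$ with $\mathbf{v}'\mathbf{G}_{2k,\mathbf{X}}\mathbf{v}_k=0$ for all $k=1,\ldots,j-1$. Coefficients: for such a sequence, $$\theta_j:=\sqrt{\max\left\{\frac{\psi_{\mathbf{X}}(\mathbf{u}_j)-q(q+2)}{\alpha_1\alpha_2(1-6\alpha_1\alpha_2)},0\right\}},\qquad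 \lambda_j:=\sqrt{\max\left\{\frac{\theta_j}{1-\alpha_1\alpha_2\theta_j},0\right\}}.$$ *)

theory Defs
  imports "HOL-Probability.Probability" "HOL-Computational_Algebra.Polynomial"
begin

text \<open>A \<open>p \<times> q\<close> matrix has type \<^typ>\<open>real^'q^'p\<close> with \<open>p = CARD('p)\<close> and \<open>q = CARD('q)\<close>
  (rows are indexed by \<open>'p\<close>).\<close>

definition pos_def_mat :: "real^'n^'n \<Rightarrow> bool" where
  "pos_def_mat A \<longleftrightarrow> transpose A = A \<and> (\<forall>x. x \<noteq> 0 \<longrightarrow> x \<bullet> (A *v x) > 0)"

text \<open>Meaningful for symmetric positive definite \<open>A\<close> only, where the square root exists and is
  unique.\<close>

definition mat_sqrt :: "real^'n^'n \<Rightarrow> real^'n^'n" where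
  "mat_sqrt A = (THE S. pos_def_mat S \<and> S ** S = A)"

definition outer_prod :: "real^'m \<Rightarrow> real^'n \<Rightarrow> real^'n^'m" where
  "outer_prod x y = (\<chi> i j. x $ i * y $ j)"

definition charpoly :: "real^'n^'n \<Rightarrow> real poly" where
  "charpoly A = det (mat [:0, 1:] - (\<chi> i j. [:A $ i $ j:]))"

text \<open>The singular values as square roots of the eigenvalues of \<open>A'A\<close>, with algebraic
  multiplicities.  There are \<open>CARD('n)\<close> of them; using \<open>AA'\<close> or keeping only the
  \<open>min (CARD('m)) (CARD('n))\<close> largest changes the multiplicity of \<open>0\<close> only.\<close>

definition singular_values :: "real^'n^'m \<Rightarrow> real multiset" where
  "singular_values A = image_mset sqrt (proots (charpoly (transpose A ** A)))"

definition distinct_nonzero_singular_values :: "real^'n^'m \<Rightarrow> bool" where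
  "distinct_nonzero_singular_values A \<longleftrightarrow>
     (\<forall>s \<in># singular_values A. s \<noteq> 0 \<longrightarrow> count (singular_values A) s = 1)"

definition std_normal_mat :: "(real^'q^'p) measure" where
  "std_normal_mat =
     distr (\<Pi>\<^sub>M ij \<in> (UNIV :: ('p \<times> 'q) set). density lborel (\<lambda>x. ennreal (std_normal_density x)))
       borel (\<lambda>z. \<chi> i j. z (i, j))"

definition normal_mat :: "real^'q^'p \<Rightarrow> real^'p^'p \<Rightarrow> real^'q^'q \<Rightarrow> (real^'q^'p) measure" where
  "normal_mat T A B = distr std_normal_mat borel (\<lambda>Z. T + mat_sqrt A ** Z ** mat_sqrt B)"

definition mixture :: "real \<Rightarrow> 'a measure \<Rightarrow> real \<Rightarrow> 'a measure \<Rightarrow> 'a measure" where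
  "mixture a P b Q =
     measure_of (space P) (sets P) (\<lambda>E. ennreal a * emeasure P E + ennreal b * emeasure Q E)"

definition centered :: "'a measure \<Rightarrow> ('a \<Rightarrow> real^'q^'p) \<Rightarrow> 'a \<Rightarrow> real^'q^'p" where
  "centered M X \<omega> = X \<omega> - integral\<^sup>L M X"

definition G1 :: "'a measure \<Rightarrow> ('a \<Rightarrow> real^'q^'p) \<Rightarrow> real^'q \<Rightarrow> real^'p^'p" where
  "G1 M X v = (LINT \<omega>|M. centered M X \<omega> ** outer_prod v v ** transpose (centered M X \<omega>))"

definition G2 :: "'a measure \<Rightarrow> ('a \<Rightarrow> real^'q^'p) \<Rightarrow> real^'p \<Rightarrow> real^'q^'q" where
  "G2 M X u = (LINT \<omega>|M. transpose (centered M X \<omega>) ** outer_prod u u ** centered M X \<omega>)"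

text \<open>The index of the transposed random matrix is \<open>psi M (\<lambda>\<omega>. transpose (X \<omega>))\<close>.\<close>

definition psi :: "'a measure \<Rightarrow> ('a \<Rightarrow> real^'q^'p) \<Rightarrow> real^'p \<Rightarrow> real" where
  "psi M X u =
     (LINT \<omega>|M. (u \<bullet> ((centered M X \<omega> ** matrix_inv (G2 M X u) ** transpose (centered M X \<omega>)) *v u))\<^sup>2)"

text \<open>Pairs are numbered \<open>1, \<dots>, d\<close>; for \<open>j = 1\<close> the orthogonality constraints are void.\<close>

definition feasible1 :: "'a measure \<Rightarrow> ('a \<Rightarrow> real^'q^'p) \<Rightarrow>
    (nat \<Rightarrow> real^'p) \<Rightarrow> (nat \<Rightarrow> real^'q) \<Rightarrow> nat \<Rightarrow> real^'p \<Rightarrow> bool" where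
  "feasible1 M X u v j x \<longleftrightarrow> x \<in> sphere 0 1 \<and> (\<forall>k\<in>{1..<j}. x \<bullet> (G1 M X (v k) *v u k) = 0)"

definition feasible2 :: "'a measure \<Rightarrow> ('a \<Rightarrow> real^'q^'p) \<Rightarrow>
    (nat \<Rightarrow> real^'p) \<Rightarrow> (nat \<Rightarrow> real^'q) \<Rightarrow> nat \<Rightarrow> real^'q \<Rightarrow> bool" where
  "feasible2 M X u v j y \<longleftrightarrow> y \<in> sphere 0 1 \<and> (\<forall>k\<in>{1..<j}. y \<bullet> (G2 M X (u k) *v v k) = 0)"

definition minimizer_seq :: "'a measure \<Rightarrow> ('a \<Rightarrow> real^'q^'p) \<Rightarrow> nat \<Rightarrow>
    (real^'p \<Rightarrow> real) \<Rightarrow> (real^'q \<Rightarrow> real) \<Rightarrow> (nat \<Rightarrow> real^'p) \<Rightarrow> (nat \<Rightarrow> real^'q) \<Rightarrow> bool" where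
  "minimizer_seq M X d g1 g2 u v \<longleftrightarrow>
     (\<forall>j\<in>{1..d}. is_arg_min g1 (feasible1 M X u v j) (u j) \<and>
                 is_arg_min g2 (feasible2 M X u v j) (v j))"

definition maximizer_seq :: "'a measure \<Rightarrow> ('a \<Rightarrow> real^'q^'p) \<Rightarrow> nat \<Rightarrow>
    (real^'p \<Rightarrow> real) \<Rightarrow> (real^'q \<Rightarrow> real) \<Rightarrow> (nat \<Rightarrow> real^'p) \<Rightarrow> (nat \<Rightarrow> real^'q) \<Rightarrow> bool" where
  "maximizer_seq M X d g1 g2 u v \<longleftrightarrow>
     (\<forall>j\<in>{1..d}. is_arg_max g1 (feasible1 M X u v j) (u j) \<and>
                 is_arg_max g2 (feasible2 M X u v j) (v j))"

definition theta :: "'a measure \<Rightarrow> ('a \<Rightarrow> real^'q^'p) \<Rightarrow> real \<Rightarrow> real \<Rightarrow> real^'p \<Rightarrow> real" where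
  "theta M X \<alpha>1 \<alpha>2 u =
     sqrt (max ((psi M X u - real CARD('q) * (real CARD('q) + 2)) / (\<alpha>1 * \<alpha>2 * (1 - 6 * \<alpha>1 * \<alpha>2))) 0)"

definition lam :: "'a measure \<Rightarrow> ('a \<Rightarrow> real^'q^'p) \<Rightarrow> real \<Rightarrow> real \<Rightarrow> real^'p \<Rightarrow> real" where
  "lam M X \<alpha>1 \<alpha>2 u = sqrt (max (theta M X \<alpha>1 \<alpha>2 u / (1 - \<alpha>1 * \<alpha>2 * theta M X \<alpha>1 \<alpha>2 u)) 0)"

definition bilin_moment :: "'a measure \<Rightarrow> ('a \<Rightarrow> real^'q^'p) \<Rightarrow> nat \<Rightarrow> real^'p \<Rightarrow> real^'q \<Rightarrow> real" where
  "bilin_moment M X k u v = (LINT \<omega>|M. (u \<bullet> (centered M X \<omega> *v v)) ^ k)"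

definition lda_sign :: "'a measure \<Rightarrow> ('a \<Rightarrow> real^'q^'p) \<Rightarrow> real \<Rightarrow> real \<Rightarrow> real^'p \<Rightarrow> real^'q \<Rightarrow> real" where
  "lda_sign M X \<alpha>1 \<alpha>2 u v = sgn (inverse (\<alpha>1 - \<alpha>2) * bilin_moment M X 3 u v)"

definition W_LDA :: "real^'q^'p \<Rightarrow> real^'q^'p \<Rightarrow> real^'p^'p \<Rightarrow> real^'q^'q \<Rightarrow> real^'q^'p" where
  "W_LDA T1 T2 A B = matrix_inv A ** (T2 - T1) ** matrix_inv B"

end

theory Submission
  imports Defs
begin

text \<open>Write \<open>A = S\<^sup>2\<close>, \<open>B = R\<^sup>2\<close>, \<open>D = T2 - T1\<close>, \<open>c = \<alpha>1 \<alpha>2\<close> and \<open>H = S\<^sup>-\<^sup>1 D R\<^sup>-\<^sup>1\<close>.  Along every direction the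
  centered matrix is a two-point variable plus an independent Gaussian, so all its linear forms have
  explicit second, third and fourth moments; polarization gives
  \<open>\<psi>(u) = q(q + 2) + c(1 - 6c) (\<eta> / (1 + c\<eta>))\<^sup>2\<close> with \<open>\<eta> = \<bar>H'Su\<bar>\<^sup>2 / \<bar>Su\<bar>\<^sup>2\<close>.  Since
  \<open>\<eta> / (1 + c\<eta>)\<close> increases in \<open>\<eta>\<close> and \<open>1 - 6c\<close> has the sign of \<open>\<bar>\<alpha>1 - 1/2\<bar> - 1/\<surd>12\<close>, both the minimizers in
  (i) and the maximizers in (iii) maximize the Rayleigh quotient \<open>\<eta>\<close>.  The constraints turn inductively into
  orthogonality of the vectors \<open>Su\<^sub>j\<close> and of the vectors \<open>Rv\<^sub>j\<close>, so these are the left and right singular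
  vectors of \<open>H\<close>, matched because the non-zero singular values are simple.  The coefficients undo the
  standardization: \<open>\<lambda>\<^sub>j\<close> is the singular value and \<open>s\<^sub>j\<close> the sign relating the \<open>j\<close>-th left and right vectors.\<close>

section \<open>Square roots of positive definite matrices\<close>


text \<open>The factor \<open>c (1 - 6c)\<close> is the fourth cumulant of the two-point variable,
  whose variance is \<open>c\<close> and whose fourth moment is \<open>c (1 - 3c)\<close>. The
  Gaussian part has no fourth cumulant, so the index leaves its Gaussian value only through this
  number, and the sign of the number decides between minimizing and maximizing. The third moment
  \<open>c (\<alpha>1 - \<alpha>2)\<close>, from which the signs are read, vanishes at equal
  weights; hence their exclusion in (i). Two obstacles shape the argument. The vectors of a pair
  come from two separate optimizations, yet each constraint matrix is built from the partner vector,
  so a pair must be recognized as a singular pair before the next constraints can be read as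
  orthogonality. Moreover, simplicity of the singular values is given as algebraic multiplicity,
  while the matching needs one-dimensional eigenspaces. The index computation uses moments of linear
  forms only, never the distribution itself, so the transposed matrix is a second instance of the
  same results.\<close>

declare transpose_matrix_vector [simp del]

lemma inner_transpose_mult: "(transpose N *v x) \<bullet> y = x \<bullet> (N *v y)"
  for N :: "real^'n^'m"
  by (metis dot_lmul_matrix transpose_matrix_vector)

lemma symmetric_mat_inner: "transpose N = N \<Longrightarrow> (N *v x) \<bullet> y = x \<bullet> (N *v y)"
  for N :: "real^'n^'n"
  by (metis inner_transpose_mult)

section \<open>Spectral theorem for symmetric matrices via Rayleigh quotients\<close>

lemma nonpos_if_quadratic_nonpos:
  fixes a b :: real
  assumes "\<And>t. 0 < t \<Longrightarrow> 2 * t * a + t\<^sup>2 * b \<le> 0"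
  shows "a \<le> 0"
proof (rule ccontr)
  assume "\<not> a \<le> 0"
  then have a: "a > 0" by simp
  \<comment> \<open>Chosen so that \<open>t * \<bar>b\<bar> \<le> a\<close>: then
    \<open>2 * a + t * b\<close> is at least \<open>a\<close>, hence positive.\<close>
  define t where "t = a / (\<bar>b\<bar> + 1)"
  have t: "t > 0" unfolding t_def using a by (simp add: add_nonneg_pos)
  have "t * \<bar>b\<bar> \<le> a" unfolding t_def using a by (simp add: field_simps)
  then have "- (t * b) \<le> a" using t
    by (smt (verit, best) mult_minus_right mult_left_mono)
  moreover have "t * (2 * a + t * b) \<le> 0" using assms[OF t] by (simp add: algebra_simps power2_eq_square)
  then have "2 * a + t * b \<le> 0" using t by (simp add: mult_le_0_iff)
  ultimately show False using a by linarith
qed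

text \<open>First-order condition at a constrained maximum. The residual \<open>r\<close> stays in
  \<open>V\<close> by invariance and is orthogonal to \<open>x\<close>, so moving from
  \<open>x\<close> to \<open>x + t r\<close> is admissible and changes the homogenized inequality by
  \<open>2 t (r \<bullet> r)\<close> to first order; this forces \<open>r = 0\<close>. The version
  inside an invariant subspace serves both the spectral theorem and the constrained
  optimizers.\<close>

lemma rayleigh_maximizer_eigenvector:
  fixes N :: "real^'n^'n"
  assumes sym: "transpose N = N" and V: "subspace V" and inv: "\<And>y. y \<in> V \<Longrightarrow> N *v y \<in> V"
    and x: "x \<in> V" "norm x = 1"
    and max: "\<And>y. y \<in> V \<Longrightarrow> norm y = 1 \<Longrightarrow> y \<bullet> (N *v y) \<le> x \<bullet> (N *v x)"
  shows "N *v x = (x \<bullet> (N *v x)) *\<^sub>R x"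
proof -
  define \<mu> where "\<mu> = x \<bullet> (N *v x)"
  define r where "r = N *v x - \<mu> *\<^sub>R x"
  have le: "y \<bullet> (N *v y) \<le> \<mu> * (y \<bullet> y)" if "y \<in> V" for y
  proof (cases "y = 0")
    case False
    define z where "z = (1 / norm y) *\<^sub>R y"
    have "z \<in> V" "norm z = 1" using that False V by (auto simp: z_def subspace_scale)
    then have "z \<bullet> (N *v z) \<le> \<mu>" using max by (simp add: \<mu>_def)
    moreover have "z \<bullet> (N *v z) = (y \<bullet> (N *v y)) / (norm y)\<^sup>2"
      by (simp add: z_def matrix_vector_mult_scaleR power2_eq_square)
    ultimately show ?thesis using False
      by (simp add: field_simps power2_norm_eq_inner)
  qed simp
  have rV: "r \<in> V" using V inv x by (simp add: r_def subspace_diff subspace_scale)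
  have xx: "x \<bullet> x = 1" using x by (simp add: norm_eq_1)
  have xr: "x \<bullet> r = 0" by (simp add: r_def inner_diff_right xx \<mu>_def)
  have Nx: "N *v x = r + \<mu> *\<^sub>R x" by (simp add: r_def)
  have "2 * t * (r \<bullet> r) + t\<^sup>2 * (r \<bullet> (N *v r) - \<mu> * (r \<bullet> r)) \<le> 0" if "t > 0" for t
  proof -
    have "x + t *\<^sub>R r \<in> V" using V x rV by (simp add: subspace_add subspace_scale)
    from le[OF this] have "(x + t *\<^sub>R r) \<bullet> (N *v (x + t *\<^sub>R r)) \<le> \<mu> * ((x + t *\<^sub>R r) \<bullet> (x + t *\<^sub>R r))" .
    moreover have "x \<bullet> (N *v r) = r \<bullet> r"
      using symmetric_mat_inner[OF sym, of x r] xr by (simp add: Nx inner_add_left)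
    moreover have "r \<bullet> (N *v x) = r \<bullet> r" using xr by (simp add: Nx inner_add_right inner_commute)
    ultimately show ?thesis
      using xr xx by (simp add: matrix_vector_right_distrib matrix_vector_mult_scaleR
          inner_add_left inner_add_right inner_commute \<mu>_def[symmetric] algebra_simps power2_eq_square)
  qed
  then have "r \<bullet> r \<le> 0" by (rule nonpos_if_quadratic_nonpos)
  then have "r = 0" by (simp add: inner_gt_zero_iff antisym_conv1 flip: not_less)
  then show ?thesis using Nx by (simp add: \<mu>_def)
qed

lemma exists_eigenvector_in_subspace:
  fixes N :: "real^'n^'n"
  assumes sym: "transpose N = N" and V: "subspace V" and inv: "\<And>y. y \<in> V \<Longrightarrow> N *v y \<in> V"
    and ne: "V \<noteq> {0}"
  obtains x \<mu> where "x \<in> V" "norm x = 1" "N *v x = \<mu> *\<^sub>R x"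
proof -
  obtain z where z: "z \<in> V" "z \<noteq> 0" using ne V subspace_0 by blast
  let ?K = "V \<inter> sphere 0 1"
  have "(1 / norm z) *\<^sub>R z \<in> ?K" using z V by (auto simp: subspace_scale)
  then have "?K \<noteq> {}" by blast
  moreover have "compact ?K"
    by (intro closed_Int_compact closed_subspace V compact_sphere)
  moreover have "continuous_on ?K (\<lambda>y. y \<bullet> (N *v y))"
    by (intro continuous_intros linear_continuous_on_compose matrix_vector_mul_linear)
  ultimately obtain x where x: "x \<in> ?K" "\<And>y. y \<in> ?K \<Longrightarrow> y \<bullet> (N *v y) \<le> x \<bullet> (N *v x)"
    using continuous_attains_sup[of ?K "\<lambda>y. y \<bullet> (N *v y)"] by blast
  have "N *v x = (x \<bullet> (N *v x)) *\<^sub>R x"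
    using x by (intro rayleigh_maximizer_eigenvector[OF sym V inv]) auto
  with x that show ?thesis by auto
qed

text \<open>Induction on the dimension: split off one eigenvector; by symmetry its orthogonal
  complement within \<open>V\<close> is invariant again and of smaller dimension.\<close>

lemma orthonormal_eigenbasis_subspace:
  fixes N :: "real^'n^'n"
  assumes sym: "transpose N = N" and "subspace V" and "\<And>y. y \<in> V \<Longrightarrow> N *v y \<in> V"
  shows "\<exists>E. E \<subseteq> V \<and> pairwise orthogonal E \<and> (\<forall>e\<in>E. norm e = 1 \<and> (\<exists>\<mu>. N *v e = \<mu> *\<^sub>R e)) \<and> V \<subseteq> span E"
  using assms(2,3)
proof (induction "dim V" arbitrary: V rule: less_induct)
  case less
  show ?case
  proof (cases "V = {0}")
    case True
    then show ?thesis by (intro exI[of _ "{}"]) auto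
  next
    case False
    obtain x \<mu> where x: "x \<in> V" "norm x = 1" "N *v x = \<mu> *\<^sub>R x"
      by (rule exists_eigenvector_in_subspace[OF sym less.prems False])
    have xx: "x \<bullet> x = 1" using x by (simp add: norm_eq_1)
    define W where "W = V \<inter> {y. x \<bullet> y = 0}"
    have W: "subspace W" unfolding W_def
      by (intro subspace_inter less.prems(1) subspace_hyperplane)
    have "x \<notin> W" using xx by (simp add: W_def)
    then have "W \<subset> V" using x(1) by (metis W_def inf_le1 psubsetI)
    then have "dim W < dim V"
      using W less.prems(1) by (intro dim_psubset) (simp add: span_eq_iff[THEN iffD2])
    moreover have "N *v y \<in> W" if "y \<in> W" for y
      using that less.prems(2) symmetric_mat_inner[OF sym, of x y] x(3) by (auto simp: W_def)
    ultimately obtain E where E: "E \<subseteq> W" "pairwise orthogonal E"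
      "\<forall>e\<in>E. norm e = 1 \<and> (\<exists>\<mu>. N *v e = \<mu> *\<^sub>R e)" "W \<subseteq> span E"
      using less.hyps[of W] W by blast
    show ?thesis
    proof (intro exI[of _ "insert x E"] conjI)
      show "insert x E \<subseteq> V" using E x by (auto simp: W_def)
      show "pairwise orthogonal (insert x E)"
        using E(1,2) by (auto simp: pairwise_insert W_def orthogonal_def inner_commute)
      show "\<forall>e\<in>insert x E. norm e = 1 \<and> (\<exists>\<mu>. N *v e = \<mu> *\<^sub>R e)" using E x by auto
      show "V \<subseteq> span (insert x E)"
      proof
        fix v assume v: "v \<in> V"
        have "v - (x \<bullet> v) *\<^sub>R x \<in> W" using v x xx less.prems(1)
          by (auto simp: W_def subspace_diff subspace_scale inner_diff_right)
        with E(4) show "v \<in> span (insert x E)" unfolding span_insert by blast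
      qed
    qed
  qed
qed

lemma orthonormal_eigenbasis:
  fixes N :: "real^'n^'n"
  assumes "transpose N = N"
  obtains E where "finite E" "\<And>e e'. e \<in> E \<Longrightarrow> e' \<in> E \<Longrightarrow> e \<bullet> e' = (if e = e' then 1 else 0)"
    "\<And>e. e \<in> E \<Longrightarrow> \<exists>\<mu>. N *v e = \<mu> *\<^sub>R e" "\<And>x. x = (\<Sum>e\<in>E. (e \<bullet> x) *\<^sub>R e)" "span E = UNIV"
proof -
  obtain E where E: "pairwise orthogonal E"
      "\<And>e. e\<in>E \<Longrightarrow> norm e = 1" "\<And>e. e\<in>E \<Longrightarrow> \<exists>\<mu>. N *v e = \<mu> *\<^sub>R e" "span E = UNIV"
    using orthonormal_eigenbasis_subspace[OF assms subspace_UNIV] by auto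
  have fin: "finite E" using E(1) by (rule pairwise_orthogonal_imp_finite)
  show ?thesis
  proof
    show "e \<bullet> e' = (if e = e' then 1 else 0)" if "e \<in> E" "e' \<in> E" for e e'
      using E(1,2) that by (auto simp: pairwise_def orthogonal_def norm_eq_1)
    show "x = (\<Sum>e\<in>E. (e \<bullet> x) *\<^sub>R e)" for x
      using orthonormal_basis_expand[OF E(1,2) _ fin, of x] E(4) by (simp add: inner_commute)
  qed (use E fin in auto)
qed

lemma eigenvalue_pos_def:
  assumes N: "pos_def_mat N" and e: "N *v e = \<mu> *\<^sub>R e" "e \<bullet> e = 1"
  shows "\<mu> > 0"
proof -
  have "e \<noteq> 0" using e(2) by auto
  with N have "e \<bullet> (N *v e) > 0" by (simp add: pos_def_mat_def)
  then show ?thesis by (simp add: e)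
qed

lemma pos_def_mat_mult_zero_iff:
  assumes "pos_def_mat N"
  shows "N *v x = 0 \<longleftrightarrow> x = 0"
  using assms by (cases "x = 0") (force simp: pos_def_mat_def)+

lemma pos_def_mat_transpose [simp]: "pos_def_mat N \<Longrightarrow> transpose N = N"
  by (simp add: pos_def_mat_def)

text \<open>On an eigenvector \<open>e\<close> of \<open>P\<close> with value \<mu>, the vector
  \<open>w = Q e - \<mu> e\<close> satisfies
  \<open>(Q + \<mu>) w = (Q\<^sup>2 - \<mu>\<^sup>2) e = 0\<close>, so \<open>w \<noteq> 0\<close>
  would give \<open>Q\<close> the negative eigenvalue -\<mu>. Uniqueness gives meaning to the
  definite description in \<open>mat_sqrt\<close>.\<close>

lemma pos_def_mat_sqrt_unique:
  fixes P Q :: "real^'n^'n"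
  assumes P: "pos_def_mat P" and Q: "pos_def_mat Q" and eq: "P ** P = Q ** Q"
  shows "P = Q"
proof -
  obtain E where E: "span E = UNIV" "\<And>e e'. e \<in> E \<Longrightarrow> e' \<in> E \<Longrightarrow> e \<bullet> e' = (if e = e' then 1 else 0)"
    "\<And>e. e \<in> E \<Longrightarrow> \<exists>\<mu>. P *v e = \<mu> *\<^sub>R e"
    by (rule orthonormal_eigenbasis[of P]) (use P in auto)
  have "P *v e = Q *v e" if e: "e \<in> E" for e
  proof -
    obtain \<mu> where \<mu>: "P *v e = \<mu> *\<^sub>R e" using E(3)[OF e] by blast
    then have pos: "\<mu> > 0" using eigenvalue_pos_def[OF P \<mu>] E(2) e by simp
    define w where "w = Q *v e - \<mu> *\<^sub>R e"
    have "Q *v (Q *v e) = \<mu>\<^sup>2 *\<^sub>R e"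
      by (metis \<mu> eq matrix_vector_mul_assoc matrix_vector_mult_scaleR power2_eq_square scaleR_scaleR)
    then have w: "Q *v w = - \<mu> *\<^sub>R w"
      by (simp add: w_def matrix_vector_mult_diff_distrib matrix_vector_mult_scaleR power2_eq_square algebra_simps)
    have "w = 0"
    proof (rule ccontr)
      assume "w \<noteq> 0"
      then have "w \<bullet> (Q *v w) > 0" using Q by (simp add: pos_def_mat_def)
      moreover have "\<mu> * (w \<bullet> w) \<ge> 0" using pos by simp
      ultimately show False by (simp add: w)
    qed
    then show ?thesis by (simp add: w_def \<mu>)
  qed
  then have "(*v) P x = (*v) Q x" for x
    using E(1) by (intro linear_eq_on[of "(*v) P" "(*v) Q" x E]) auto
  then show ?thesis by (simp add: matrix_eq)
qed

lemma pos_def_mat_sqrt_exists: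
  fixes N :: "real^'n^'n"
  assumes N: "pos_def_mat N"
  shows "\<exists>S. pos_def_mat S \<and> S ** S = N"
proof -
  obtain E where fin: "finite E" and E: "\<And>e e'. e \<in> E \<Longrightarrow> e' \<in> E \<Longrightarrow> e \<bullet> e' = (if e = e' then 1 else 0)"
    "\<And>e. e \<in> E \<Longrightarrow> \<exists>\<mu>. N *v e = \<mu> *\<^sub>R e" and ex: "\<And>x. x = (\<Sum>e\<in>E. (e \<bullet> x) *\<^sub>R e)"
    by (rule orthonormal_eigenbasis[of N]) (use N in auto)
  obtain \<mu> where \<mu>: "\<And>e. e \<in> E \<Longrightarrow> N *v e = \<mu> e *\<^sub>R e" using E(2) by metis
  have pos: "\<mu> e > 0" if "e \<in> E" for e
    using eigenvalue_pos_def[OF N \<mu>] E(1) that by simp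
  \<comment> \<open>Functional calculus: \<open>f\<close> multiplies each vector of the eigenbasis
    by the square root of its eigenvalue.\<close>
  define f where "f x = (\<Sum>e\<in>E. (sqrt (\<mu> e) * (e \<bullet> x)) *\<^sub>R e)" for x
  have lin: "linear f"
    unfolding f_def by (rule linearI) (simp_all add: inner_add_right algebra_simps sum.distrib scaleR_sum_right)
  have fE: "e \<bullet> f x = sqrt (\<mu> e) * (e \<bullet> x)" if "e \<in> E" for e x
  proof -
    have "e \<bullet> f x = (\<Sum>e'\<in>E. (sqrt (\<mu> e') * (e' \<bullet> x)) * (if e = e' then 1 else 0))"
      unfolding f_def inner_sum_right by (intro sum.cong refl) (simp add: E(1) that)
    also have "\<dots> = sqrt (\<mu> e) * (e \<bullet> x)" using fin that by (subst sum.remove[of E e]) (auto intro!: sum.neutral split: if_splits)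
    finally show ?thesis .
  qed
  define S where "S = matrix f"
  have S: "S *v x = f x" for x by (simp add: S_def lin)
  have inner_f: "x \<bullet> f y = (\<Sum>e\<in>E. sqrt (\<mu> e) * (e \<bullet> x) * (e \<bullet> y))" for x y
    unfolding f_def inner_sum_right by (intro sum.cong refl) (simp add: inner_commute)
  have "(transpose S *v x) \<bullet> y = (S *v x) \<bullet> y" for x y
    unfolding inner_transpose_mult S inner_f inner_commute[of "f x" y]
    by (intro sum.cong refl) simp
  then have "transpose S *v x = S *v x" for x
    by (metis vector_eq_rdot)
  then have "transpose S = S" by (simp add: matrix_eq)
  moreover have "x \<bullet> (S *v x) > 0" if "x \<noteq> 0" for x
  proof -
    obtain e where e: "e \<in> E" "e \<bullet> x \<noteq> 0"
    proof (rule ccontr)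
      assume "\<not> thesis"
      with that have "(\<Sum>e\<in>E. (e \<bullet> x) *\<^sub>R e) = 0" by (intro sum.neutral) auto
      with ex[of x] \<open>x \<noteq> 0\<close> show False by metis
    qed
    have "0 < sqrt (\<mu> e) * ((e \<bullet> x) * (e \<bullet> x))" using e pos by (simp add: zero_less_mult_iff not_less) (meson linorder_neqE_linordered_idom)
    then have "0 < sqrt (\<mu> e) * (e \<bullet> x) * (e \<bullet> x)" by (simp add: mult.assoc)
    also have "\<dots> \<le> (\<Sum>e\<in>E. sqrt (\<mu> e) * (e \<bullet> x) * (e \<bullet> x))"
      using pos by (intro member_le_sum fin e) (simp add: mult.assoc less_imp_le)
    finally show ?thesis by (simp add: S inner_f)
  qed
  ultimately have "pos_def_mat S" by (simp add: pos_def_mat_def)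
  moreover have "S *v (S *v x) = N *v x" for x
  proof -
    have "S *v (S *v x) = (\<Sum>e\<in>E. (\<mu> e * (e \<bullet> x)) *\<^sub>R e)"
      unfolding S f_def[of "f x"] 
      by (intro sum.cong refl) (simp add: fE pos less_imp_le flip: mult.assoc)
    also have "\<dots> = (\<Sum>e\<in>E. (e \<bullet> x) *\<^sub>R (N *v e))"
      by (intro sum.cong refl) (simp add: \<mu> mult.commute)
    also have "\<dots> = N *v (\<Sum>e\<in>E. (e \<bullet> x) *\<^sub>R e)"
      by (simp add: matrix_vector_mult_scaleR linear_sum[OF matrix_vector_mul_linear])
    finally show ?thesis by (simp only: ex[of x, symmetric])
  qed
  then have "S ** S = N" by (simp add: matrix_eq matrix_vector_mul_assoc[symmetric])
  ultimately show ?thesis by blast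
qed

lemma mat_sqrt:
  assumes "pos_def_mat N"
  shows pos_def_mat_sqrt: "pos_def_mat (mat_sqrt N)" and mat_sqrt_mult: "mat_sqrt N ** mat_sqrt N = N"
proof -
  have "\<exists>!S. pos_def_mat S \<and> S ** S = N"
    using pos_def_mat_sqrt_exists[OF assms] pos_def_mat_sqrt_unique by metis
  from theI'[OF this] show "pos_def_mat (mat_sqrt N)" "mat_sqrt N ** mat_sqrt N = N"
    by (simp_all add: mat_sqrt_def)
qed

lemma invertible_pos_def: "pos_def_mat N \<Longrightarrow> invertible N"
  by (simp add: invertible_left_inverse matrix_left_invertible_ker pos_def_mat_mult_zero_iff)

lemma matrix_inv_unique:
  fixes N L :: "real^'n^'n"
  assumes "N ** L = mat 1"
  shows "matrix_inv N = L"
proof -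
  have LN: "L ** N = mat 1" using assms by (simp add: matrix_left_right_inverse)
  have "\<exists>L. N ** L = mat 1 \<and> L ** N = mat 1" using assms LN by blast
  from someI_ex[OF this] have inv: "N ** matrix_inv N = mat 1" unfolding matrix_inv_def by (rule conjunct1)
  have "matrix_inv N = (L ** N) ** matrix_inv N" by (simp only: LN matrix_mul_lid)
  also have "\<dots> = L ** (N ** matrix_inv N)" by (simp only: matrix_mul_assoc)
  also have "\<dots> = L" by (simp only: inv matrix_mul_rid)
  finally show ?thesis .
qed

section \<open>Singular vectors\<close>


lemma poly_det: "poly (det M) t = det (\<chi> i j. poly (M $ i $ j) t)"
  for M :: "real poly^'n^'n"
  by (simp add: det_def poly_sum poly_prod)

text \<open>Every Leibniz term contains one entry from each of the two columns. Passing to the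
  transpose indexes the products by columns, so the divisibility holds for an arbitrary map \<pi>,
  not just a permutation.\<close>

lemma dvd_det_of_dvd_two_columns:
  fixes M :: "'a::comm_ring_1^'n^'n"
  assumes ne: "j0 \<noteq> j1" and "\<And>i. p dvd M $ i $ j0" "\<And>i. p dvd M $ i $ j1"
  shows "p\<^sup>2 dvd det M"
proof -
  have "p\<^sup>2 dvd (\<Prod>i\<in>UNIV. transpose M $ i $ \<pi> i)" for \<pi> :: "'n \<Rightarrow> 'n"
  proof -
    have "(\<Prod>i\<in>UNIV. transpose M $ i $ \<pi> i)
        = (transpose M $ j0 $ \<pi> j0 * transpose M $ j1 $ \<pi> j1) * (\<Prod>i\<in>UNIV - {j0} - {j1}. transpose M $ i $ \<pi> i)"
      using ne by (simp add: prod.remove[of UNIV j0] prod.remove[of "UNIV - {j0}" j1] mult.assoc)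
    moreover have "p * p dvd transpose M $ j0 $ \<pi> j0 * transpose M $ j1 $ \<pi> j1"
      using assms by (intro mult_dvd_mono) (simp_all add: transpose_def)
    ultimately show ?thesis by (simp add: power2_eq_square)
  qed
  then have "p\<^sup>2 dvd det (transpose M)" unfolding det_def by (intro dvd_sum dvd_mult) auto
  then show ?thesis by simp
qed

text \<open>A two-dimensional eigenspace forces a double root. Complete the two eigenvectors to a
  basis and take it as the columns of \<open>P\<close>: two columns of \<open>(t I - N) P\<close>
  are then divisible by \<open>t - \<mu>\<close>, and \<open>det P\<close> is a nonzero constant.
  Multiplying on one side only avoids inverting a matrix of polynomials.\<close>

lemma square_dvd_charpoly:
  fixes N :: "real^'n^'n"
  assumes ind: "independent {w1, w2}" and ne: "w1 \<noteq> w2"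
    and w1: "N *v w1 = \<mu> *\<^sub>R w1" and w2: "N *v w2 = \<mu> *\<^sub>R w2"
  shows "[:- \<mu>, 1:]\<^sup>2 dvd charpoly N"
proof -
  obtain E where E: "{w1, w2} \<subseteq> E" "independent E" "UNIV \<subseteq> span E"
    by (rule maximal_independent_subset_extend[of "{w1, w2}" UNIV]) (use ind in auto)
  have "card E = CARD('n)"
    using E basis_card_eq_dim[of E UNIV] by simp
  then obtain f :: "'n \<Rightarrow> real^'n" where f: "bij_betw f UNIV E"
    using finite_same_card_bij[of "UNIV :: 'n set" E] E(2) independent_imp_finite by force
  define P :: "real^'n^'n" where "P = (\<chi> i j. f j $ i)"
  have "columns P = E" using f by (auto simp: columns_def column_def P_def bij_betw_def)
  then have "\<exists>L. P ** L = mat 1" using E(3) by (simp add: matrix_right_invertible_span_columns span_vec_eq top.extremum_unique)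
  then have detP: "det P \<noteq> 0" by (simp add: invertible_det_nz[symmetric] invertible_right_inverse)
  obtain j0 j1 where j: "f j0 = w1" "f j1 = w2" using f E(1) by (auto simp: bij_betw_def)
  then have j01: "j0 \<noteq> j1" using ne by auto
  let ?C = "\<lambda>L::real^'n^'n. (\<chi> i j. [:L $ i $ j:])"
  let ?M = "(mat [:0, 1:] - ?C N) ** ?C P"
  have NP: "(\<Sum>k\<in>UNIV. N $ i $ k * P $ k $ j) = (N *v f j) $ i" for i j
    by (simp add: matrix_vector_mult_def P_def)
  \<comment> \<open>Column \<open>j\<close> of the product is \<open>t f j - N (f j)\<close>, which
    for an eigenvector is \<open>(t - \<mu>) f j\<close>.\<close>
  have M: "?M $ i $ j = [:0, 1:] * [:P $ i $ j:] - [:(N *v f j) $ i:]" for i j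
  proof -
    have "?M $ i $ j = (\<Sum>k\<in>UNIV. (if i = k then [:0, 1:] else 0) * [:P $ k $ j:] - [:N $ i $ k * P $ k $ j:])"
      by (simp add: matrix_matrix_mult_def mat_def smult_diff_right mult.commute)
    also have "\<dots> = (\<Sum>k\<in>UNIV. (if i = k then [:0, 1:] * [:P $ k $ j:] else 0)) - (\<Sum>k\<in>UNIV. [:N $ i $ k * P $ k $ j:])"
      by (simp only: sum_subtractf) (intro arg_cong2[of _ _ _ _ "(-)"] sum.cong, auto)
    also have "(\<Sum>k\<in>UNIV. [:N $ i $ k * P $ k $ j:]) = [:(N *v f j) $ i:]"
      unfolding NP[symmetric] by (rule poly_eqI) (simp add: coeff_sum coeff_pCons split: nat.split)
    finally show ?thesis by simp
  qed
  have "[:- \<mu>, 1:] dvd ?M $ i $ j0" for i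
    unfolding M j w1 by (rule dvdI[of _ _ "[:w1 $ i:]"]) (simp add: P_def j)
  moreover have "[:- \<mu>, 1:] dvd ?M $ i $ j1" for i
    unfolding M j w2 by (rule dvdI[of _ _ "[:w2 $ i:]"]) (simp add: P_def j)
  ultimately have "[:- \<mu>, 1:]\<^sup>2 dvd det ?M" by (rule dvd_det_of_dvd_two_columns[OF j01])
  then have "[:- \<mu>, 1:]\<^sup>2 dvd charpoly N * det (?C P)" by (simp add: det_mul charpoly_def)
  moreover have "det (?C P) = [:det P:]"
    by (simp add: det_def poly_eq_poly_eq_iff[symmetric] poly_sum poly_prod fun_eq_iff)
  ultimately have "[:- \<mu>, 1:]\<^sup>2 dvd smult (det P) (charpoly N)" by simp
  then show ?thesis using detP by (simp add: dvd_smult_iff)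
qed

text \<open>Divisibility by a power translates into a root multiplicity only for a nonzero
  polynomial. The value at -1 is nonzero because the positive semidefinite \<open>H'H\<close> cannot
  have the eigenvalue -1.\<close>

lemma charpoly_gram_nonzero:
  fixes H :: "real^'n^'m"
  shows "charpoly (transpose H ** H) \<noteq> 0"
proof
  let ?N = "transpose H ** H"
  assume "charpoly ?N = 0"
  then have "poly (charpoly ?N) (- 1) = 0" by simp
  moreover have "poly (charpoly ?N) (- 1) = det (mat (- 1) - ?N)"
    unfolding charpoly_def poly_det
    by (rule arg_cong[of _ _ det]) (simp add: vec_eq_iff mat_def)
  ultimately have "\<not> invertible (mat (- 1) - ?N)" by (simp add: invertible_det_nz)
  then obtain x where x: "x \<noteq> 0" "(mat (- 1) - ?N) *v x = 0"
    by (auto simp: invertible_left_inverse matrix_left_invertible_ker)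
  have "mat (- 1) *v x = - x"
    by (simp add: vec_eq_iff matrix_vector_mult_def mat_def if_distrib[of "\<lambda>a. a * _"] cong: if_cong)
  with x(2) have "?N *v x = - x" by (simp add: matrix_vector_mult_diff_rdistrib)
  then have "x \<bullet> (?N *v x) = - (x \<bullet> x)" by simp
  moreover have "x \<bullet> (?N *v x) = (H *v x) \<bullet> (H *v x)"
    by (simp add: matrix_vector_mul_assoc[symmetric] inner_commute[of x] inner_transpose_mult)
  ultimately show False using x(1) by (smt (verit) inner_ge_zero inner_gt_zero_iff)
qed

text \<open>Bridge from the multiset hypothesis to geometry: two independent eigenvectors would give
  a double root, hence a nonzero singular value counted at least twice.\<close>

lemma simple_singular_eigenspace:
  fixes H :: "real^'q^'p"
  assumes dist: "distinct_nonzero_singular_values H" and \<mu>: "\<mu> \<noteq> 0"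
    and w1: "transpose H *v (H *v w1) = \<mu> *\<^sub>R w1" "w1 \<noteq> 0"
    and w2: "transpose H *v (H *v w2) = \<mu> *\<^sub>R w2"
  shows "\<exists>t. w2 = t *\<^sub>R w1"
proof (rule ccontr)
  assume no: "\<not> ?thesis"
  let ?p = "charpoly (transpose H ** H)"
  have "w2 \<notin> span {w1}" using no by (auto simp: span_singleton)
  moreover have "w1 \<noteq> w2" using no scaleR_one by metis
  ultimately have "independent {w2, w1}" using w1(2) by (simp add: independent_insert)
  then have "[:- \<mu>, 1:]\<^sup>2 dvd ?p"
    using square_dvd_charpoly[of w1 w2 "transpose H ** H" \<mu>] \<open>w1 \<noteq> w2\<close> w1 w2
    by (simp add: matrix_vector_mul_assoc insert_commute)
  then have "2 \<le> order \<mu> ?p" by (simp add: order_divides charpoly_gram_nonzero)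
  then have root: "2 \<le> count (proots ?p) \<mu>" by (simp add: charpoly_gram_nonzero)
  \<comment> \<open>The count in the image multiset is a sum over the fibre of \<open>sqrt\<close>;
    keeping the one term at \<mu> is enough, without any injectivity.\<close>
  also have "\<dots> \<le> count (singular_values H) (sqrt \<mu>)"
    unfolding singular_values_def 
    unfolding count_image_mset
  proof (rule member_le_sum)
    have "\<mu> \<in># proots ?p" using root by (metis count_eq_zero_iff not_numeral_le_zero)
    then show "\<mu> \<in> sqrt -` {sqrt \<mu>} \<inter> set_mset (proots ?p)" by simp
  qed auto
  finally have two: "2 \<le> count (singular_values H) (sqrt \<mu>)" .
  then have "sqrt \<mu> \<in># singular_values H" by (simp add: count_greater_zero_iff[symmetric] del: count_greater_zero_iff)
  then show False using dist two \<mu> by (auto simp: distinct_nonzero_singular_values_def)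
qed

section \<open>Singular pairs and rank-one expansions\<close>

lemma outer_prod_mult:
  fixes x :: "real^'n" and y z :: "real^'m" and P :: "real^'n^'p" and Q :: "real^'q^'m"
  shows matrix_mult_outer_prod: "P ** outer_prod x y = outer_prod (P *v x) y"
    and outer_prod_matrix_mult: "outer_prod x y ** Q = outer_prod x (transpose Q *v y)"
    and outer_prod_mult_vector: "outer_prod x y *v z = (y \<bullet> z) *\<^sub>R x"
  by (simp_all add: vec_eq_iff outer_prod_def matrix_matrix_mult_def matrix_vector_mult_def transpose_def
      inner_vec_def sum_distrib_left sum_distrib_right mult_ac)

lemma sum_matrix_vector_mult: "(\<Sum>k\<in>K. f k) *v z = (\<Sum>k\<in>K. f k *v z)"
  for f :: "'b \<Rightarrow> real^'q^'p"
  by (induction K rule: infinite_finite_induct) (auto simp: matrix_vector_mult_add_rdistrib)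

text \<open>\<open>rank H\<close> pairs with nonzero values already exhaust the range. If the
  expansion failed at \<open>z\<close>, the residual \<open>r\<close> would lie in the range, be
  nonzero and be orthogonal to all \<open>x k\<close>, which themselves lie in the range because
  \<open>\<tau> k \<noteq> 0\<close>; that is one independent vector too many.\<close>

lemma matrix_expansion_of_singular_pairs:
  fixes H :: "real^'q^'p" and K :: "nat set"
  assumes fin: "finite K" and card: "card K = rank H"
    and onx: "\<And>k l. k \<in> K \<Longrightarrow> l \<in> K \<Longrightarrow> x k \<bullet> x l = (if k = l then 1 else 0)"
    and ony: "\<And>k l. k \<in> K \<Longrightarrow> l \<in> K \<Longrightarrow> y k \<bullet> y l = (if k = l then 1 else 0)"
    and pair: "\<And>k. k \<in> K \<Longrightarrow> H *v y k = \<tau> k *\<^sub>R x k" "\<And>k. k \<in> K \<Longrightarrow> transpose H *v x k = \<tau> k *\<^sub>R y k"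
    and nz: "\<And>k. k \<in> K \<Longrightarrow> \<tau> k \<noteq> 0"
  shows "H = (\<Sum>k\<in>K. \<tau> k *\<^sub>R outer_prod (x k) (y k))"
proof -
  have "H *v z = (\<Sum>k\<in>K. (\<tau> k * (y k \<bullet> z)) *\<^sub>R x k)" for z
  proof (rule ccontr)
    define r where "r = H *v z - (\<Sum>k\<in>K. (\<tau> k * (y k \<bullet> z)) *\<^sub>R x k)"
    assume "\<not> ?thesis"
    then have r0: "r \<noteq> 0" by (simp add: r_def)
    have rx: "x k \<bullet> r = 0" if k: "k \<in> K" for k
    proof -
      have "x k \<bullet> (\<Sum>l\<in>K. (\<tau> l * (y l \<bullet> z)) *\<^sub>R x l) = (\<Sum>l\<in>K. if k = l then \<tau> l * (y l \<bullet> z) else 0)"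
        unfolding inner_sum_right by (intro sum.cong refl) (simp add: onx k)
      also have "\<dots> = \<tau> k * (y k \<bullet> z)" using fin k by simp
      also have "\<dots> = x k \<bullet> (H *v z)" using inner_transpose_mult[of H "x k" z] pair(2)[OF k] by simp
      finally show ?thesis by (simp add: r_def inner_diff_right)
    qed
    have inj: "inj_on x K" using onx by (intro inj_onI) (metis zero_neq_one)
    have xnr: "r \<notin> x ` K"
    proof
      assume "r \<in> x ` K"
      then obtain l where "l \<in> K" "r = x l" by blast
      then have "r \<bullet> r = 0" using rx[of l] by simp
      with r0 show False by simp
    qed
    have "pairwise orthogonal (insert r (x ` K))"
      using rx onx by (auto simp: pairwise_def orthogonal_def inner_commute)
    moreover have "0 \<notin> insert r (x ` K)" using r0 onx by (auto simp: image_iff) (metis inner_zero_left zero_neq_one)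
    ultimately have ind: "independent (insert r (x ` K))" by (rule pairwise_orthogonal_independent)
    have "H *v ((1 / \<tau> k) *\<^sub>R y k) = x k" if "k \<in> K" for k
      using pair(1)[OF that] nz[OF that] by (simp add: matrix_vector_mult_scaleR)
    then have "x k \<in> range ((*v) H)" if "k \<in> K" for k using that by (metis rangeI)
    moreover have sub: "subspace (range ((*v) H))"
      by (intro linear_subspace_image matrix_vector_mul_linear subspace_UNIV)
    ultimately have "insert r (x ` K) \<subseteq> range ((*v) H)"
      unfolding r_def by (auto intro!: subspace_diff subspace_sum subspace_scale)
    from independent_card_le_dim[OF this ind] have "card (insert r (x ` K)) \<le> rank H"
      by (simp add: rank_dim_range)
    then show False using xnr fin card by (simp add: card_image inj)
  qed
  then show ?thesis
    by (simp add: matrix_eq outer_prod_mult_vector sum_matrix_vector_mult scaleR_matrix_vector_assoc[symmetric])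
qed

text \<open>Matches two maximizers that were chosen independently. \<open>H\<close> and its
  transpose exchange the orthogonal complements \<open>U\<close> and \<open>V\<close> of the earlier
  vectors, so \<open>x0\<close> and \<open>y0\<close> are eigenvectors of \<open>HH'\<close> and
  \<open>H'H\<close>. Each transports to a competitor in the other problem, which equates the two
  eigenvalues; simplicity then makes \<open>H'x0\<close> a multiple of \<open>y0\<close>.\<close>

lemma maximizers_form_singular_pair:
  fixes H :: "real^'q^'p" and K :: "nat set"
  assumes dist: "distinct_nonzero_singular_values H"
    and fin: "finite K" and card: "card K < rank H"
    and pair: "\<And>k. k \<in> K \<Longrightarrow> H *v y k = \<tau> k *\<^sub>R x k" "\<And>k. k \<in> K \<Longrightarrow> transpose H *v x k = \<tau> k *\<^sub>R y k"
    and x0: "norm x0 = 1" "\<And>k. k \<in> K \<Longrightarrow> x0 \<bullet> x k = 0"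
    and x0max: "\<And>z. norm z = 1 \<Longrightarrow> (\<And>k. k \<in> K \<Longrightarrow> z \<bullet> x k = 0) \<Longrightarrow> norm (transpose H *v z) \<le> norm (transpose H *v x0)"
    and y0: "norm y0 = 1" "\<And>k. k \<in> K \<Longrightarrow> y0 \<bullet> y k = 0"
    and y0max: "\<And>z. norm z = 1 \<Longrightarrow> (\<And>k. k \<in> K \<Longrightarrow> z \<bullet> y k = 0) \<Longrightarrow> norm (H *v z) \<le> norm (H *v y0)"
  shows "\<exists>t. t \<noteq> 0 \<and> H *v y0 = t *\<^sub>R x0 \<and> transpose H *v x0 = t *\<^sub>R y0"
proof -
  let ?H' = "transpose H"
  define V where "V = {z. \<forall>k\<in>K. z \<bullet> x k = 0}"
  define U where "U = {z. \<forall>k\<in>K. z \<bullet> y k = 0}"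
  have subV: "subspace V" and subU: "subspace U"
    by (auto simp: V_def U_def subspace_def inner_add_left)
  have HU: "?H' *v z \<in> U" if "z \<in> V" for z
    using that pair(1) by (auto simp: U_def V_def inner_transpose_mult)
  have HV: "H *v z \<in> V" if "z \<in> U" for z
  proof -
    have "(H *v z) \<bullet> x k = z \<bullet> (?H' *v x k)" for k
      by (metis inner_commute inner_transpose_mult)
    then show ?thesis using that pair(2) by (auto simp: U_def V_def)
  qed
  have sq: "z \<bullet> ((H ** ?H') *v z) = (norm (?H' *v z))\<^sup>2" for z
    by (simp add: matrix_vector_mul_assoc[symmetric] power2_norm_eq_inner inner_transpose_mult[symmetric])
  have sq': "z \<bullet> ((?H' ** H) *v z) = (norm (H *v z))\<^sup>2" for z
    by (simp add: matrix_vector_mul_assoc[symmetric] power2_norm_eq_inner inner_commute[of z] inner_transpose_mult)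
  define \<mu> where "\<mu> = (norm (?H' *v x0))\<^sup>2"
  define \<nu> where "\<nu> = (norm (H *v y0))\<^sup>2"
  have "(H ** ?H') *v x0 = (x0 \<bullet> ((H ** ?H') *v x0)) *\<^sub>R x0"
  proof (rule rayleigh_maximizer_eigenvector[OF _ subV])
    show "transpose (H ** ?H') = H ** ?H'" by (simp add: matrix_transpose_mul)
    show "(H ** ?H') *v z \<in> V" if "z \<in> V" for z
      using HU HV that by (simp add: matrix_vector_mul_assoc[symmetric])
    show "x0 \<in> V" "norm x0 = 1" using x0 by (auto simp: V_def)
    show "z \<bullet> ((H ** ?H') *v z) \<le> x0 \<bullet> ((H ** ?H') *v x0)" if "z \<in> V" "norm z = 1" for z
      using x0max[of z] that unfolding sq V_def by (simp add: power_mono)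
  qed
  then have ex: "H *v (?H' *v x0) = \<mu> *\<^sub>R x0" unfolding sq \<mu>_def by (simp add: matrix_vector_mul_assoc)
  have "(?H' ** H) *v y0 = (y0 \<bullet> ((?H' ** H) *v y0)) *\<^sub>R y0"
  proof (rule rayleigh_maximizer_eigenvector[OF _ subU])
    show "transpose (?H' ** H) = ?H' ** H" by (simp add: matrix_transpose_mul)
    show "(?H' ** H) *v z \<in> U" if "z \<in> U" for z
      using HU HV that by (simp add: matrix_vector_mul_assoc[symmetric])
    show "y0 \<in> U" "norm y0 = 1" using y0 by (auto simp: U_def)
    show "z \<bullet> ((?H' ** H) *v z) \<le> y0 \<bullet> ((?H' ** H) *v y0)" if "z \<in> U" "norm z = 1" for z
      using y0max[of z] that unfolding sq' U_def by (simp add: power_mono)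
  qed
  then have ey: "?H' *v (H *v y0) = \<nu> *\<^sub>R y0" unfolding sq' \<nu>_def by (simp add: matrix_vector_mul_assoc)
  \<comment> \<open>Otherwise \<open>H'\<close> vanishes on \<open>V\<close>, so the range of
    \<open>H\<close> lies in the span of the \<open>x k\<close>, whose dimension is below the
    rank.\<close>
  have "\<mu> \<noteq> 0"
  proof
    assume "\<mu> = 0"
    have zero: "?H' *v z = 0" if "z \<in> V" for z
    proof (cases "z = 0")
      case False
      have "norm (?H' *v ((1 / norm z) *\<^sub>R z)) \<le> norm (?H' *v x0)"
        using that False by (intro x0max) (auto simp: V_def)
      then show ?thesis using \<open>\<mu> = 0\<close> False by (simp add: \<mu>_def matrix_vector_mult_scaleR divide_le_0_iff)
    qed simp
    have "H *v z \<in> span (x ` K)" for z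
    proof -
      obtain a b where ab: "a \<in> span (x ` K)" "\<And>w. w \<in> span (x ` K) \<Longrightarrow> orthogonal b w" "H *v z = a + b"
        using orthogonal_subspace_decomp_exists[of "x ` K" "H *v z"] by metis
      have "b \<in> V" using ab(2) by (auto simp: V_def orthogonal_def span_base)
      then have "b \<bullet> (H *v z) = 0" using zero inner_transpose_mult[of H b z] by simp
      moreover have "b \<bullet> a = 0" using ab by (simp add: orthogonal_def)
      ultimately have "b = 0" using ab(3) by (simp add: inner_add_right)
      then show ?thesis using ab by simp
    qed
    then have "rank H \<le> dim (x ` K)" unfolding rank_dim_range by (metis dim_span dim_subset image_subsetI)
    also have "\<dots> \<le> card K" using fin by (meson card_image_le dim_le_card' finite_imageI le_trans)
    finally show False using card by simp
  qed
  then have \<mu>: "\<mu> > 0" by (simp add: \<mu>_def)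
  \<comment> \<open>The normalized vector \<open>H'x0\<close> competes with \<open>y0\<close> and
    attains the value \<open>\<mu> / sqrt \<mu>\<close>.\<close>
  have "\<mu> \<le> \<nu>"
  proof -
    have n: "norm (?H' *v x0) = sqrt \<mu>" by (simp add: \<mu>_def)
    have "norm (H *v ((1 / sqrt \<mu>) *\<^sub>R (?H' *v x0))) \<le> norm (H *v y0)"
      using HU[of x0] x0 \<mu> by (intro y0max) (auto simp: U_def V_def n)
    then have "\<mu> / sqrt \<mu> \<le> norm (H *v y0)" using \<mu> by (simp add: matrix_vector_mult_scaleR ex x0)
    then have "sqrt \<mu> \<le> norm (H *v y0)" using \<mu> by (simp add: real_div_sqrt)
    then show ?thesis using \<mu> unfolding \<nu>_def by (simp add: real_le_rsqrt real_sqrt_le_iff sqrt_le_D)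
  qed
  with \<mu> have \<nu>: "\<nu> > 0" by simp
  have "\<nu> \<le> \<mu>"
  proof -
    have n: "norm (H *v y0) = sqrt \<nu>" by (simp add: \<nu>_def)
    have "norm (?H' *v ((1 / sqrt \<nu>) *\<^sub>R (H *v y0))) \<le> norm (?H' *v x0)"
      using HV[of y0] y0 \<nu> by (intro x0max) (auto simp: U_def V_def n)
    then have "\<nu> / sqrt \<nu> \<le> norm (?H' *v x0)" using \<nu> by (simp add: matrix_vector_mult_scaleR ey y0)
    then have "sqrt \<nu> \<le> norm (?H' *v x0)" using \<nu> by (simp add: real_div_sqrt)
    then show ?thesis using \<nu> unfolding \<mu>_def by (simp add: sqrt_le_D)
  qed
  with \<open>\<mu> \<le> \<nu>\<close> have eq: "\<nu> = \<mu>" by simp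
  have "\<exists>t. ?H' *v x0 = t *\<^sub>R y0"
    using y0 \<mu> by (intro simple_singular_eigenspace[OF dist, of \<mu>])
      (auto simp: ey eq ex matrix_vector_mult_scaleR)
  then obtain t where t: "?H' *v x0 = t *\<^sub>R y0" by blast
  have t2: "\<mu> = t\<^sup>2" using y0 by (simp add: \<mu>_def t)
  then have "t \<noteq> 0" using \<mu> by auto
  \<comment> \<open>Apply \<open>H\<close> to \<open>H'x0 = t y0\<close> and cancel \<open>t\<close>
    in \<open>t H y0 = t\<^sup>2 x0\<close>.\<close>
  moreover have "t *\<^sub>R (H *v y0) = t *\<^sub>R (t *\<^sub>R x0)"
    using ex by (simp add: t t2 matrix_vector_mult_scaleR power2_eq_square)
  ultimately have "H *v y0 = t *\<^sub>R x0" using scaleR_left_imp_eq by blast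
  with \<open>t \<noteq> 0\<close> t show ?thesis by blast
qed

section \<open>Gaussian matrices and mixtures\<close>


text \<open>The inner product of matrices is the Frobenius one; multiplication by a matrix has
  multiplication by its transpose as adjoint. This moves square roots from the random matrix to the
  coefficient matrix.\<close>

lemma inner_matrix_mult_left: "C \<bullet> (P ** Z) = (transpose P ** C) \<bullet> Z"
  for C :: "real^'q^'p" and P :: "real^'m^'p" and Z :: "real^'q^'m"
proof -
  have "C \<bullet> (P ** Z) = (\<Sum>i\<in>UNIV. \<Sum>j\<in>UNIV. \<Sum>k\<in>UNIV. C $ i $ j * P $ i $ k * Z $ k $ j)"
    by (simp add: inner_vec_def matrix_matrix_mult_def sum_distrib_left mult.assoc)
  also have "\<dots> = (\<Sum>i\<in>UNIV. \<Sum>k\<in>UNIV. \<Sum>j\<in>UNIV. C $ i $ j * P $ i $ k * Z $ k $ j)"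
    by (intro sum.cong refl sum.swap)
  also have "\<dots> = (\<Sum>k\<in>UNIV. \<Sum>i\<in>UNIV. \<Sum>j\<in>UNIV. C $ i $ j * P $ i $ k * Z $ k $ j)"
    by (rule sum.swap)
  also have "\<dots> = (\<Sum>k\<in>UNIV. \<Sum>j\<in>UNIV. \<Sum>i\<in>UNIV. C $ i $ j * P $ i $ k * Z $ k $ j)"
    by (intro sum.cong refl sum.swap)
  also have "\<dots> = (transpose P ** C) \<bullet> Z"
    by (simp add: inner_vec_def matrix_matrix_mult_def transpose_def sum_distrib_right sum_distrib_left mult_ac)
  finally show ?thesis .
qed

lemma inner_transpose: "transpose C \<bullet> transpose Z = C \<bullet> Z" for C Z :: "real^'q^'p"
  unfolding inner_vec_def transpose_def by (simp add: sum.swap[of _ "UNIV :: 'q set"])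

lemma inner_matrix_mult_right: "C \<bullet> (Z ** Q) = (C ** transpose Q) \<bullet> Z"
  for C :: "real^'q^'p" and Q :: "real^'q^'m" and Z :: "real^'m^'p"
proof -
  have "C \<bullet> (Z ** Q) = transpose C \<bullet> (transpose Q ** transpose Z)"
    by (metis inner_transpose matrix_transpose_mul)
  also have "\<dots> = (C ** transpose Q) \<bullet> Z"
    unfolding inner_matrix_mult_left by (metis inner_transpose matrix_transpose_mul transpose_transpose)
  finally show ?thesis .
qed

section \<open>Moments of linear forms in a standard normal matrix\<close>

lemma distributed_normal_moment:
  assumes "distributed M lborel Y (\<lambda>x. ennreal (normal_density 0 \<sigma> x))" and "\<sigma> > 0"
    and "has_bochner_integral lborel (\<lambda>x. normal_density 0 \<sigma> x * x ^ n) v"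
  shows "has_bochner_integral M (\<lambda>\<omega>. Y \<omega> ^ n) v"
proof -
  have "integrable M (\<lambda>\<omega>. Y \<omega> ^ n)"
    using distributed_integrable[OF assms(1), of "\<lambda>x. x ^ n"] assms(3)
    by (simp add: has_bochner_integral_iff)
  moreover have "integral\<^sup>L M (\<lambda>\<omega>. Y \<omega> ^ n) = v"
    using distributed_integral[OF assms(1), of "\<lambda>x. x ^ n"] assms(3)
    by (simp add: has_bochner_integral_iff)
  ultimately show ?thesis by (simp add: has_bochner_integral_iff)
qed

context
  fixes D :: "real measure" and P :: "('p::finite \<times> 'q::finite \<Rightarrow> real) measure"
  defines "D \<equiv> density lborel (\<lambda>x. ennreal (std_normal_density x))"
    and "P \<equiv> PiM (UNIV :: ('p \<times> 'q) set) (\<lambda>_. D)"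
begin

lemma prob_space_std_normal_density: "prob_space D"
  unfolding D_def by (rule prob_space_normal_density) simp

lemma prob_space_std_normal_PiM: "prob_space P"
  unfolding P_def by (intro prob_space_PiM prob_space_std_normal_density)

lemma std_normal_PiM_borel: "sets P = sets (PiM UNIV (\<lambda>_. borel :: real measure))"
  unfolding P_def by (intro sets_PiM_cong) (simp_all add: D_def)

lemma std_normal_coord_measurable [measurable]: "(\<lambda>z. z ij) \<in> borel_measurable P"
proof -
  have "(\<lambda>z. z ij) \<in> measurable (PiM UNIV (\<lambda>_. borel)) (borel :: real measure)"
    by (rule measurable_component_singleton) simp
  then show ?thesis using measurable_cong_sets[OF std_normal_PiM_borel refl] by blast
qed

lemma std_normal_coord_distr: "distr P borel (\<lambda>z. z ij) = D"
proof -
  have "distr P borel (\<lambda>z. z ij) = distr P D (\<lambda>z. z ij)"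
    by (intro distr_cong) (simp_all add: D_def)
  also have "\<dots> = D"
    unfolding P_def by (rule distr_PiM_component) (auto intro: prob_space_std_normal_density)
  finally show ?thesis .
qed

text \<open>The joint law of the coordinates is the product measure itself, so it agrees with the
  product of its marginals.\<close>

lemma std_normal_coord_indep: "prob_space.indep_vars P (\<lambda>_. borel) (\<lambda>ij z. z ij) UNIV"
proof (subst prob_space.indep_vars_iff_distr_eq_PiM'[OF prob_space_std_normal_PiM])
  have "distr P (PiM UNIV (\<lambda>_. borel)) (\<lambda>z. restrict z UNIV) = P"
    using distr_id2[OF std_normal_PiM_borel[symmetric]] by (simp add: restrict_UNIV)
  then show "distr P (PiM UNIV (\<lambda>_. borel)) (\<lambda>z. restrict (\<lambda>ij. z ij) UNIV) = PiM UNIV (\<lambda>ij. distr P borel (\<lambda>z. z ij))"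
    unfolding std_normal_coord_distr by (simp add: P_def)
qed auto

lemma distributed_std_normal_inner:
  fixes C :: "real^'q^'p"
  assumes "C \<noteq> 0"
  shows "distributed P lborel (\<lambda>z. C \<bullet> (\<chi> i j. z (i, j))) (\<lambda>x. ennreal (normal_density 0 (norm C) x))"
proof -
  interpret prob_space P by (rule prob_space_std_normal_PiM)
  \<comment> \<open>Zero coefficients are dropped because the theorem on sums of independent normals
    wants positive standard deviations; \<open>C \<noteq> 0\<close> keeps the index set
    nonempty.\<close>
  define I where "I = {ij. C $ fst ij $ snd ij \<noteq> 0}"
  have fin: "finite I" by simp
  have ne: "I \<noteq> {}" using assms by (force simp: I_def vec_eq_iff)
  have coord: "distributed P lborel (\<lambda>z. z ij) (\<lambda>x. ennreal (std_normal_density x))" for ij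
  proof -
    have "distr P lborel (\<lambda>z. z ij) = distr P borel (\<lambda>z. z ij)" by (intro distr_cong) simp_all
    then show ?thesis
      using std_normal_coord_distr[of ij] std_normal_coord_measurable[of ij]
      by (simp add: distributed_def D_def)
  qed
  have ind: "indep_vars (\<lambda>_. borel) (\<lambda>ij z. C $ fst ij $ snd ij * z ij) I"
    using indep_vars_compose2[OF indep_vars_subset[OF std_normal_coord_indep, of I],
        of "\<lambda>ij x. C $ fst ij $ snd ij * x" "\<lambda>_. borel"] by simp
  have "distributed P lborel (\<lambda>z. \<Sum>ij\<in>I. C $ fst ij $ snd ij * z ij)
      (normal_density (\<Sum>ij\<in>I. 0) (sqrt (\<Sum>ij\<in>I. \<bar>C $ fst ij $ snd ij\<bar>\<^sup>2)))"
  proof (rule sum_indep_normal[OF fin ne ind])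
    show "0 < \<bar>C $ fst ij $ snd ij\<bar>" if "ij \<in> I" for ij using that by (simp add: I_def)
    show "distributed P lborel (\<lambda>z. C $ fst ij $ snd ij * z ij)
        (normal_density 0 \<bar>C $ fst ij $ snd ij\<bar>)" if "ij \<in> I" for ij
      using normal_density_affine[OF coord[of ij] zero_less_one, of "C $ fst ij $ snd ij" 0] that
      by (simp add: I_def)
  qed
  moreover have "(\<Sum>ij\<in>I. C $ fst ij $ snd ij * z ij) = C \<bullet> (\<chi> i j. z (i, j))" for z
  proof -
    have "(\<Sum>ij\<in>I. C $ fst ij $ snd ij * z ij) = (\<Sum>ij\<in>UNIV. C $ fst ij $ snd ij * z ij)"
      by (intro sum.mono_neutral_left) (auto simp: I_def)
    also have "\<dots> = C \<bullet> (\<chi> i j. z (i, j))"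
      by (simp add: inner_vec_def sum.cartesian_product case_prod_beta flip: UNIV_Times_UNIV)
    finally show ?thesis .
  qed
  moreover have "(\<Sum>ij\<in>I. \<bar>C $ fst ij $ snd ij\<bar>\<^sup>2) = (norm C)\<^sup>2"
  proof -
    have "(\<Sum>ij\<in>I. \<bar>C $ fst ij $ snd ij\<bar>\<^sup>2) = (\<Sum>ij\<in>UNIV. (C $ fst ij $ snd ij)\<^sup>2)"
      unfolding power2_abs by (intro sum.mono_neutral_left) (auto simp: I_def)
    also have "\<dots> = C \<bullet> C"
      by (simp add: inner_vec_def sum.cartesian_product case_prod_beta power2_eq_square flip: UNIV_Times_UNIV)
    finally show ?thesis by (simp add: power2_norm_eq_inner)
  qed
  ultimately show ?thesis by simp
qed

lemma std_normal_vec_measurable: "(\<lambda>z. \<chi> i j. z (i, j)) \<in> borel_measurable P"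
  by (rule borel_measurable_euclidean_space[THEN iffD2]) (auto simp: Basis_vec_def inner_axis)

lemma std_normal_mat_eq: "std_normal_mat = distr P borel (\<lambda>z. \<chi> i j. z (i, j))"
  by (simp add: std_normal_mat_def P_def D_def)

lemma prob_space_std_normal_mat: "prob_space (std_normal_mat :: (real^'q^'p) measure)"
  unfolding std_normal_mat_eq
  by (rule prob_space.prob_space_distr[OF prob_space_std_normal_PiM std_normal_vec_measurable])

text \<open>The case \<open>C = 0\<close> is separate since the form is then constant and has no
  density; \<open>n > 0\<close> makes its power zero.\<close>

lemma has_bochner_integral_std_normal_mat:
  fixes C :: "real^'q^'p"
  assumes "C \<noteq> 0 \<Longrightarrow> has_bochner_integral lborel (\<lambda>x. normal_density 0 (norm C) x * x ^ n) v"
    and "C = 0 \<Longrightarrow> v = 0" and "n > 0"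
  shows "has_bochner_integral std_normal_mat (\<lambda>Z. (C \<bullet> Z) ^ n) v"
proof (cases "C = 0")
  case True
  then show ?thesis using assms by (simp add: has_bochner_integral_zero zero_power)
next
  case False
  then show ?thesis
    unfolding std_normal_mat_eq
    by (intro has_bochner_integral_distr std_normal_vec_measurable
        distributed_normal_moment[OF distributed_std_normal_inner] assms(1)) auto
qed

end

lemma std_normal_mat_moments:
  fixes C :: "real^'q^'p"
  shows "has_bochner_integral std_normal_mat (\<lambda>Z. C \<bullet> Z) 0"
    "has_bochner_integral std_normal_mat (\<lambda>Z. (C \<bullet> Z)\<^sup>2) (C \<bullet> C)"
    "has_bochner_integral std_normal_mat (\<lambda>Z. (C \<bullet> Z) ^ 3) 0"
    "has_bochner_integral std_normal_mat (\<lambda>Z. (C \<bullet> Z) ^ 4) (3 * (C \<bullet> C)\<^sup>2)"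
proof -
  have odd: "has_bochner_integral std_normal_mat (\<lambda>Z. (C \<bullet> Z) ^ (2 * k + 1)) 0" for k
    using normal_moment_odd[of "norm C" 0 k] by (intro has_bochner_integral_std_normal_mat) auto
  show "has_bochner_integral std_normal_mat (\<lambda>Z. C \<bullet> Z) 0"
    using odd[of 0] by simp
  show "has_bochner_integral std_normal_mat (\<lambda>Z. (C \<bullet> Z) ^ 3) 0"
    using odd[of 1] by (simp add: numeral_3_eq_3)
  show "has_bochner_integral std_normal_mat (\<lambda>Z. (C \<bullet> Z)\<^sup>2) (C \<bullet> C)"
    using normal_moment_even[of "norm C" 0 1]
    by (intro has_bochner_integral_std_normal_mat) (auto simp: power2_norm_eq_inner)
  show "has_bochner_integral std_normal_mat (\<lambda>Z. (C \<bullet> Z) ^ 4) (3 * (C \<bullet> C)\<^sup>2)"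
    using normal_moment_even[of "norm C" 0 2]
    by (intro has_bochner_integral_std_normal_mat)
      (auto simp: power2_norm_eq_inner fact_numeral power_divide field_simps)
qed

lemma std_normal_mat_shifted_moments:
  fixes C :: "real^'q^'p"
  defines "s \<equiv> C \<bullet> C"
  shows "has_bochner_integral std_normal_mat (\<lambda>Z. t + C \<bullet> Z) t"
    "has_bochner_integral std_normal_mat (\<lambda>Z. (t + C \<bullet> Z)\<^sup>2) (t\<^sup>2 + s)"
    "has_bochner_integral std_normal_mat (\<lambda>Z. (t + C \<bullet> Z) ^ 3) (t ^ 3 + 3 * t * s)"
    "has_bochner_integral std_normal_mat (\<lambda>Z. (t + C \<bullet> Z) ^ 4) (t ^ 4 + 6 * t\<^sup>2 * s + 3 * s\<^sup>2)"
proof -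
  interpret prob_space "std_normal_mat :: (real^'q^'p) measure"
    by (rule prob_space_std_normal_mat)
  have const: "has_bochner_integral std_normal_mat (\<lambda>Z::real^'q^'p. a) a" for a :: real
    by (simp add: has_bochner_integral_iff prob_space)
  note m = std_normal_mat_moments[of C, folded s_def]
  show "has_bochner_integral std_normal_mat (\<lambda>Z. t + C \<bullet> Z) t"
    using has_bochner_integral_add[OF const[of t] m(1)] by simp
  have "has_bochner_integral std_normal_mat (\<lambda>Z. t\<^sup>2 + 2 * t * (C \<bullet> Z) + (C \<bullet> Z)\<^sup>2) (t\<^sup>2 + 2 * t * 0 + s)"
    by (intro has_bochner_integral_add has_bochner_integral_mult_right const m)
  then show "has_bochner_integral std_normal_mat (\<lambda>Z. (t + C \<bullet> Z)\<^sup>2) (t\<^sup>2 + s)"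
    by (simp add: power2_eq_square algebra_simps)
  have "has_bochner_integral std_normal_mat
      (\<lambda>Z. t ^ 3 + 3 * t\<^sup>2 * (C \<bullet> Z) + 3 * t * (C \<bullet> Z)\<^sup>2 + (C \<bullet> Z) ^ 3) (t ^ 3 + 3 * t\<^sup>2 * 0 + 3 * t * s + 0)"
    by (intro has_bochner_integral_add has_bochner_integral_mult_right const m)
  moreover have "t ^ 3 + 3 * t\<^sup>2 * a + 3 * t * a\<^sup>2 + a ^ 3 = (t + a) ^ 3" for a
    by (simp add: power2_eq_square power3_eq_cube algebra_simps)
  ultimately show "has_bochner_integral std_normal_mat (\<lambda>Z. (t + C \<bullet> Z) ^ 3) (t ^ 3 + 3 * t * s)"
    by simp
  have "has_bochner_integral std_normal_mat
      (\<lambda>Z. t ^ 4 + 4 * t ^ 3 * (C \<bullet> Z) + 6 * t\<^sup>2 * (C \<bullet> Z)\<^sup>2 + 4 * t * (C \<bullet> Z) ^ 3 + (C \<bullet> Z) ^ 4)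
      (t ^ 4 + 4 * t ^ 3 * 0 + 6 * t\<^sup>2 * s + 4 * t * 0 + 3 * s\<^sup>2)"
    by (intro has_bochner_integral_add has_bochner_integral_mult_right const m)
  moreover have "t ^ 4 + 4 * t ^ 3 * a + 6 * t\<^sup>2 * a\<^sup>2 + 4 * t * a ^ 3 + a ^ 4 = (t + a) ^ 4" for a
    by (simp add: power2_eq_square power3_eq_cube power4_eq_xxxx algebra_simps)
  ultimately show "has_bochner_integral std_normal_mat (\<lambda>Z. (t + C \<bullet> Z) ^ 4) (t ^ 4 + 6 * t\<^sup>2 * s + 3 * s\<^sup>2)"
    by simp
qed

section \<open>Integration against a two-component mixture\<close>

lemma emeasure_mixture:
  assumes "sets Q = sets P" and "E \<in> sets P"
  shows "emeasure (mixture a P b Q) E = ennreal a * emeasure P E + ennreal b * emeasure Q E"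
  unfolding mixture_def
proof (rule emeasure_measure_of_sigma[OF sets.sigma_algebra_axioms _ _ assms(2)])
  show "positive (sets P) (\<lambda>E. ennreal a * emeasure P E + ennreal b * emeasure Q E)"
    by (simp add: positive_def)
  show "countably_additive (sets P) (\<lambda>E. ennreal a * emeasure P E + ennreal b * emeasure Q E)"
  proof (rule countably_additiveI)
    fix F :: "nat \<Rightarrow> _" assume F: "range F \<subseteq> sets P" "disjoint_family F"
    have "(\<Sum>i. ennreal a * emeasure P (F i) + ennreal b * emeasure Q (F i))
        = ennreal a * (\<Sum>i. emeasure P (F i)) + ennreal b * (\<Sum>i. emeasure Q (F i))"
      by (simp add: suminf_add[symmetric])
    also have "\<dots> = ennreal a * emeasure P (\<Union>i. F i) + ennreal b * emeasure Q (\<Union>i. F i)"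
      using F assms(1) by (simp add: suminf_emeasure)
    finally show "(\<Sum>i. ennreal a * emeasure P (F i) + ennreal b * emeasure Q (F i))
        = ennreal a * emeasure P (\<Union>i. F i) + ennreal b * emeasure Q (\<Union>i. F i)" .
  qed
qed

lemma sets_mixture [simp]: "sets (mixture a P b Q) = sets P"
  and space_mixture [simp]: "space (mixture a P b Q) = space P"
  by (simp_all add: mixture_def)

lemma nn_integral_mixture:
  assumes sets: "sets Q = sets P" and "f \<in> borel_measurable P"
  shows "(\<integral>\<^sup>+x. f x \<partial>mixture a P b Q) = ennreal a * (\<integral>\<^sup>+x. f x \<partial>P) + ennreal b * (\<integral>\<^sup>+x. f x \<partial>Q)"
  using assms(2)
proof induction
  note [measurable_cong] = sets sets_mixture[of a P b Q]
  have sp: "space Q = space P" by (rule sets_eq_imp_space_eq[OF sets])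
  {
    case (cong f g)
    have "(\<integral>\<^sup>+x. f x \<partial>R) = (\<integral>\<^sup>+x. g x \<partial>R)" if "space R = space P" for R :: "'a measure"
      using cong(3) that by (intro nn_integral_cong) auto
    from this[of P] this[of Q] this[of "mixture a P b Q"] show ?case using cong(4) sp by simp
  next
    case (set A)
    then show ?case using sets by (simp add: emeasure_mixture)
  next
    case (mult u c)
    then show ?case by (simp add: nn_integral_cmult distrib_left mult.left_commute)
  next
    case (add u v)
    then show ?case by (simp add: nn_integral_add distrib_left ac_simps)
  next
    case (seq U)
    have m: "\<And>i. U i \<in> borel_measurable R" if "sets R = sets P" for R
      using seq(1) measurable_cong_sets[OF that refl] by blast
    have "(\<integral>\<^sup>+x. (SUP i. U i) x \<partial>R) = (SUP i. \<integral>\<^sup>+x. U i x \<partial>R)" if "sets R = sets P" for R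
      unfolding SUP_apply using m[OF that] seq(3) by (intro nn_integral_monotone_convergence_SUP) auto
    from this[of P] this[of Q] this[of "mixture a P b Q"] sets
    have eq: "(\<integral>\<^sup>+x. (SUP i. U i) x \<partial>P) = (SUP i. \<integral>\<^sup>+x. U i x \<partial>P)"
      "(\<integral>\<^sup>+x. (SUP i. U i) x \<partial>Q) = (SUP i. \<integral>\<^sup>+x. U i x \<partial>Q)"
      "(\<integral>\<^sup>+x. (SUP i. U i) x \<partial>mixture a P b Q) = (SUP i. \<integral>\<^sup>+x. U i x \<partial>mixture a P b Q)"
      by simp_all
    have inc: "incseq (\<lambda>i. c * (\<integral>\<^sup>+x. U i x \<partial>R))" for R c
      using seq(3) by (intro incseq_SucI mult_left_mono nn_integral_mono) (auto simp: incseq_Suc_iff le_fun_def)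
    show ?case unfolding eq seq SUP_mult_left_ennreal by (rule ennreal_SUP_add[OF inc inc])
  }
qed

text \<open>Linearity in the measure is available for nonnegative integrands, so it is applied to
  the positive and the negative part of \<open>f\<close>.\<close>

lemma has_bochner_integral_mixture:
  fixes f :: "'a \<Rightarrow> real"
  assumes sets: "sets Q = sets P" and f: "has_bochner_integral P f x" "has_bochner_integral Q f y"
    and ab: "0 \<le> a" "0 \<le> b"
  shows "has_bochner_integral (mixture a P b Q) f (a * x + b * y)"
proof -
  have fP: "integrable P f" "integrable Q f" and xy: "integral\<^sup>L P f = x" "integral\<^sup>L Q f = y"
    using f by (simp_all add: has_bochner_integral_iff)
  then have m: "f \<in> borel_measurable P" by auto
  then have mm: "f \<in> borel_measurable (mixture a P b Q)"
    using measurable_cong_sets[OF sets_mixture refl] by blast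
  have nn: "(\<integral>\<^sup>+x. ennreal (g x) \<partial>mixture a P b Q) = ennreal (a * (\<integral>x. g x \<partial>P) + b * (\<integral>x. g x \<partial>Q))"
    if "integrable P g" "integrable Q g" "\<And>x. 0 \<le> g x" for g :: "'a \<Rightarrow> real"
  proof -
    have gm: "(\<lambda>x. ennreal (g x)) \<in> borel_measurable P" using that(1) by simp
    have "(\<integral>\<^sup>+x. ennreal (g x) \<partial>mixture a P b Q)
        = ennreal a * ennreal (\<integral>x. g x \<partial>P) + ennreal b * ennreal (\<integral>x. g x \<partial>Q)"
      using that nn_integral_mixture[OF sets gm] by (simp add: nn_integral_eq_integral)
    also have "\<dots> = ennreal (a * (\<integral>x. g x \<partial>P) + b * (\<integral>x. g x \<partial>Q))"
      using ab that by (simp add: ennreal_mult[symmetric] ennreal_plus[symmetric] del: ennreal_plus)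
    finally show ?thesis .
  qed
  have gi: "integrable (mixture a P b Q) g \<and> integral\<^sup>L (mixture a P b Q) g = a * integral\<^sup>L P g + b * integral\<^sup>L Q g"
    if "integrable P g" "integrable Q g" "\<And>x. 0 \<le> g x" for g :: "'a \<Rightarrow> real"
  proof -
    have gm: "g \<in> borel_measurable (mixture a P b Q)"
      using that(1) measurable_cong_sets[OF sets_mixture[of a P b Q] refl] by blast
    have "has_bochner_integral (mixture a P b Q) g (a * integral\<^sup>L P g + b * integral\<^sup>L Q g)"
      using that ab by (intro has_bochner_integral_nn_integral gm nn) auto
    then show ?thesis by (simp add: has_bochner_integral_iff)
  qed
  have "has_bochner_integral (mixture a P b Q) (\<lambda>x. max 0 (f x) - max 0 (- f x))
      ((a * (\<integral>x. max 0 (f x) \<partial>P) + b * (\<integral>x. max 0 (f x) \<partial>Q)) - (a * (\<integral>x. max 0 (- f x) \<partial>P) + b * (\<integral>x. max 0 (- f x) \<partial>Q)))"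
    using gi[of "\<lambda>x. max 0 (f x)"] gi[of "\<lambda>x. max 0 (- f x)"] fP
    by (intro has_bochner_integral_diff) (auto simp: has_bochner_integral_iff)
  moreover have "(\<lambda>x. max 0 (f x) - max 0 (- f x)) = f" by auto
  moreover have "(\<integral>x. max 0 (f x) \<partial>R) - (\<integral>x. max 0 (- f x) \<partial>R) = (\<integral>x. f x \<partial>R)" if "integrable R f" for R
  proof -
    have "(\<integral>x. max 0 (f x) \<partial>R) - (\<integral>x. max 0 (- f x) \<partial>R) = (\<integral>x. max 0 (f x) - max 0 (- f x) \<partial>R)"
      using that by (intro Bochner_Integration.integral_diff[symmetric]) auto
    also have "\<dots> = (\<integral>x. f x \<partial>R)" by (intro Bochner_Integration.integral_cong) auto
    finally show ?thesis .
  qed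
  from this[OF fP(1)] this[OF fP(2)] xy
  have "(a * (\<integral>x. max 0 (f x) \<partial>P) + b * (\<integral>x. max 0 (f x) \<partial>Q)) - (a * (\<integral>x. max 0 (- f x) \<partial>P) + b * (\<integral>x. max 0 (- f x) \<partial>Q)) = a * x + b * y"
    by (simp add: algebra_simps flip: right_diff_distrib)
  ultimately show ?thesis by simp
qed


text \<open>Bilinear forms are inner products with rank-one coefficients, so moments of all linear
  forms \<open>C \<bullet> Z\<close> cover every moment in the statement.\<close>

lemma outer_prod_inner: "outer_prod x y \<bullet> Z = x \<bullet> (Z *v y)"
  for Z :: "real^'q^'p"
  by (simp add: inner_vec_def outer_prod_def matrix_vector_mult_def sum_distrib_left mult_ac)

lemma has_bochner_integral_matrix:
  fixes f :: "'a \<Rightarrow> real^'q^'p"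
  assumes "\<And>i j. has_bochner_integral M (\<lambda>\<omega>. f \<omega> $ i $ j) (F $ i $ j)"
  shows "has_bochner_integral M f F"
proof -
  have expand: "Z = (\<Sum>i\<in>UNIV. \<Sum>j\<in>UNIV. (Z $ i $ j) *\<^sub>R outer_prod (axis i 1) (axis j 1))"
    for Z :: "real^'q^'p"
    by (simp add: vec_eq_iff outer_prod_def axis_def if_distrib[of "\<lambda>x. _ * x"] cong: if_cong)
  have "has_bochner_integral M
      (\<lambda>\<omega>. \<Sum>i\<in>UNIV. \<Sum>j\<in>UNIV. (f \<omega> $ i $ j) *\<^sub>R (outer_prod (axis i 1) (axis j 1) :: real^'q^'p))
      (\<Sum>i\<in>UNIV. \<Sum>j\<in>UNIV. (F $ i $ j) *\<^sub>R outer_prod (axis i 1) (axis j 1))"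
    by (intro has_bochner_integral_sum has_bochner_integral_scaleR_left assms)
  then show ?thesis by (simp flip: expand)
qed

lemma borel_measurable_matrix_mult: "(\<lambda>Z. T + P ** Z ** Q) \<in> borel_measurable borel"
  for T :: "real^'q^'p" and P :: "real^'m^'p" and Q :: "real^'q^'n" and Z :: "real^'n^'m"
proof -
  have "linear (\<lambda>Z :: real^'n^'m. P ** Z ** Q)"
    by (rule linearI) (simp_all add: vec_eq_iff matrix_matrix_mult_def sum_distrib_left sum_distrib_right sum.distrib algebra_simps)
  then have "continuous_on UNIV (\<lambda>Z. T + P ** Z ** Q)"
    by (intro continuous_intros linear_continuous_on) (simp add: linear_conv_bounded_linear)
  then show ?thesis by (rule borel_measurable_continuous_onI)
qed

text \<open>The second identity gives the variance of the Gaussian part of the linear form with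
  coefficient \<open>C\<close>.\<close>

lemma inner_normal_mat_argument:
  fixes C T :: "real^'q^'p"
  assumes "pos_def_mat A" and "pos_def_mat B"
  shows "C \<bullet> (T + mat_sqrt A ** Z ** mat_sqrt B) = C \<bullet> T + (mat_sqrt A ** C ** mat_sqrt B) \<bullet> Z"
    and "(mat_sqrt A ** C ** mat_sqrt B) \<bullet> (mat_sqrt A ** C ** mat_sqrt B) = C \<bullet> (A ** C ** B)"
proof -
  have t: "transpose (mat_sqrt A) = mat_sqrt A" "transpose (mat_sqrt B) = mat_sqrt B"
    using assms by (simp_all add: pos_def_mat_sqrt)
  have inner: "C \<bullet> (mat_sqrt A ** Z ** mat_sqrt B) = (mat_sqrt A ** C ** mat_sqrt B) \<bullet> Z"
    for C Z :: "real^'q^'p"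
    by (simp only: inner_matrix_mult_right[of C "mat_sqrt A ** Z"]
        inner_matrix_mult_left[of "C ** _"] t matrix_mul_assoc)
  then show "C \<bullet> (T + mat_sqrt A ** Z ** mat_sqrt B) = C \<bullet> T + (mat_sqrt A ** C ** mat_sqrt B) \<bullet> Z"
    by (simp add: inner_add_right)
  have "(mat_sqrt A ** C ** mat_sqrt B) \<bullet> (mat_sqrt A ** C ** mat_sqrt B)
      = C \<bullet> (mat_sqrt A ** (mat_sqrt A ** C ** mat_sqrt B) ** mat_sqrt B)"
    by (simp add: inner)
  also have "mat_sqrt A ** (mat_sqrt A ** C ** mat_sqrt B) ** mat_sqrt B
      = (mat_sqrt A ** mat_sqrt A) ** C ** (mat_sqrt B ** mat_sqrt B)"
    by (simp only: matrix_mul_assoc)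
  finally show "(mat_sqrt A ** C ** mat_sqrt B) \<bullet> (mat_sqrt A ** C ** mat_sqrt B) = C \<bullet> (A ** C ** B)"
    using assms by (simp add: mat_sqrt_mult)
qed

section \<open>Moments of the centered normal mixture\<close>

locale normal_mixture = prob_space M for M :: "'a measure" +
  fixes X :: "'a \<Rightarrow> real^'q^'p" and T1 T2 :: "real^'q^'p" and A :: "real^'p^'p" and B :: "real^'q^'q"
    and \<alpha>1 \<alpha>2 :: real
  assumes X_measurable: "X \<in> borel_measurable M"
    and \<alpha>1: "0 < \<alpha>1" "\<alpha>1 < 1" and \<alpha>2: "\<alpha>2 = 1 - \<alpha>1"
    and A: "pos_def_mat A" and B: "pos_def_mat B"
    and distr_X: "distr M borel X = mixture \<alpha>1 (normal_mat T1 A B) \<alpha>2 (normal_mat T2 A B)"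
begin

lemma has_bochner_integral_X:
  fixes f :: "real^'q^'p \<Rightarrow> real"
  assumes f: "f \<in> borel_measurable borel"
    and "has_bochner_integral std_normal_mat (\<lambda>Z. f (T1 + mat_sqrt A ** Z ** mat_sqrt B)) x1"
    and "has_bochner_integral std_normal_mat (\<lambda>Z. f (T2 + mat_sqrt A ** Z ** mat_sqrt B)) x2"
  shows "has_bochner_integral M (\<lambda>\<omega>. f (X \<omega>)) (\<alpha>1 * x1 + \<alpha>2 * x2)"
proof -
  have m: "(\<lambda>Z. T + mat_sqrt A ** Z ** mat_sqrt B) \<in> measurable std_normal_mat borel" for T :: "real^'q^'p"
    using borel_measurable_matrix_mult[of T "mat_sqrt A" "mat_sqrt B"]
    by (simp add: std_normal_mat_def)
  have "has_bochner_integral (distr M borel X) f (\<alpha>1 * x1 + \<alpha>2 * x2)"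
    unfolding distr_X using \<alpha>1 \<alpha>2
    by (intro has_bochner_integral_mixture)
      (auto simp: normal_mat_def intro!: has_bochner_integral_distr f m assms)
  then show ?thesis
    using f X_measurable by (simp add: has_bochner_integral_iff integrable_distr_eq integral_distr)
qed

lemma has_bochner_integral_X_mean: "has_bochner_integral M X (\<alpha>1 *\<^sub>R T1 + \<alpha>2 *\<^sub>R T2)"
proof (rule has_bochner_integral_matrix)
  fix i j
  let ?C = "outer_prod (axis i 1) (axis j 1) :: real^'q^'p"
  have entry: "?C \<bullet> Z = Z $ i $ j" for Z
    by (simp add: outer_prod_inner inner_axis' matrix_vector_mul_component inner_axis)
  have "has_bochner_integral M (\<lambda>\<omega>. ?C \<bullet> X \<omega>) (\<alpha>1 * (?C \<bullet> T1) + \<alpha>2 * (?C \<bullet> T2))"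
    by (intro has_bochner_integral_X) (simp_all only: inner_normal_mat_argument[OF A B] std_normal_mat_shifted_moments, simp)
  then show "has_bochner_integral M (\<lambda>\<omega>. X \<omega> $ i $ j) ((\<alpha>1 *\<^sub>R T1 + \<alpha>2 *\<^sub>R T2) $ i $ j)"
    by (simp add: entry)
qed

lemma inner_centered: "C \<bullet> centered M X \<omega> = C \<bullet> X \<omega> - (\<alpha>1 * (C \<bullet> T1) + \<alpha>2 * (C \<bullet> T2))"
  using has_bochner_integral_X_mean
  by (simp add: centered_def has_bochner_integral_iff inner_diff_right inner_add_right)

text \<open>The centered mixture is distributed as \<open>\<xi> D\<close> plus the Gaussian part with \<open>D = T2 - T1\<close>, where
  \<open>\<xi> = - \<alpha>2\<close> with probability \<open>\<alpha>1\<close> and \<open>\<xi> = \<alpha>1\<close> with probability \<open>\<alpha>2\<close>.\<close>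

lemma has_bochner_integral_centered_power:
  assumes "\<And>t. has_bochner_integral std_normal_mat (\<lambda>Z. (t + (mat_sqrt A ** C ** mat_sqrt B) \<bullet> Z) ^ n) (m t)"
  shows "has_bochner_integral M (\<lambda>\<omega>. (C \<bullet> centered M X \<omega>) ^ n)
    (\<alpha>1 * m (- \<alpha>2 * (C \<bullet> (T2 - T1))) + \<alpha>2 * m (\<alpha>1 * (C \<bullet> (T2 - T1))))"
proof -
  have t: "C \<bullet> T1 - (\<alpha>1 * (C \<bullet> T1) + \<alpha>2 * (C \<bullet> T2)) = - \<alpha>2 * (C \<bullet> (T2 - T1))"
    "C \<bullet> T2 - (\<alpha>1 * (C \<bullet> T1) + \<alpha>2 * (C \<bullet> T2)) = \<alpha>1 * (C \<bullet> (T2 - T1))"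
    by (simp_all add: \<alpha>2 inner_diff_right algebra_simps)
  have shift: "C \<bullet> (T + mat_sqrt A ** Z ** mat_sqrt B) - r = (C \<bullet> T - r) + (mat_sqrt A ** C ** mat_sqrt B) \<bullet> Z" for T Z r
    by (simp add: inner_normal_mat_argument[OF A B])
  show ?thesis
    unfolding inner_centered
    by (intro has_bochner_integral_X) (simp_all only: shift t assms, measurable)
qed

text \<open>The constants are moments of the two-point variable: variance \<open>c\<close>, third
  moment \<open>c (\<alpha>1 - \<alpha>2)\<close>, fourth moment \<open>c (1 - 3c)\<close>. The term
  \<open>6 c m\<^sup>2 s\<close> is the binomial cross term of its variance with the Gaussian
  variance \<open>s\<close>.\<close>

lemma centered_moments:
  fixes C :: "real^'q^'p"
  defines "m \<equiv> C \<bullet> (T2 - T1)" and "s \<equiv> C \<bullet> (A ** C ** B)" and "c \<equiv> \<alpha>1 * \<alpha>2"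
  shows "has_bochner_integral M (\<lambda>\<omega>. (C \<bullet> centered M X \<omega>)\<^sup>2) (c * m\<^sup>2 + s)"
    and "has_bochner_integral M (\<lambda>\<omega>. (C \<bullet> centered M X \<omega>) ^ 3) (c * (\<alpha>1 - \<alpha>2) * m ^ 3)"
    and "has_bochner_integral M (\<lambda>\<omega>. (C \<bullet> centered M X \<omega>) ^ 4)
      (c * (1 - 3 * c) * m ^ 4 + 6 * c * m\<^sup>2 * s + 3 * s\<^sup>2)"
proof -
  note sh = std_normal_mat_shifted_moments[where C = "mat_sqrt A ** C ** mat_sqrt B", unfolded inner_normal_mat_argument(2)[OF A B], folded s_def]
  have "\<alpha>1 * ((- \<alpha>2 * m)\<^sup>2 + s) + \<alpha>2 * ((\<alpha>1 * m)\<^sup>2 + s) = c * m\<^sup>2 + s"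
    unfolding c_def \<alpha>2 by algebra
  then show "has_bochner_integral M (\<lambda>\<omega>. (C \<bullet> centered M X \<omega>)\<^sup>2) (c * m\<^sup>2 + s)"
    using has_bochner_integral_centered_power[OF sh(2)] by (simp only: m_def)
  have "\<alpha>1 * ((- \<alpha>2 * m) ^ 3 + 3 * (- \<alpha>2 * m) * s) + \<alpha>2 * ((\<alpha>1 * m) ^ 3 + 3 * (\<alpha>1 * m) * s) = c * (\<alpha>1 - \<alpha>2) * m ^ 3"
    unfolding c_def \<alpha>2 by algebra
  then show "has_bochner_integral M (\<lambda>\<omega>. (C \<bullet> centered M X \<omega>) ^ 3) (c * (\<alpha>1 - \<alpha>2) * m ^ 3)"
    using has_bochner_integral_centered_power[OF sh(3)] by (simp only: m_def)
  have "\<alpha>1 * ((- \<alpha>2 * m) ^ 4 + 6 * (- \<alpha>2 * m)\<^sup>2 * s + 3 * s\<^sup>2) + \<alpha>2 * ((\<alpha>1 * m) ^ 4 + 6 * (\<alpha>1 * m)\<^sup>2 * s + 3 * s\<^sup>2)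
      = c * (1 - 3 * c) * m ^ 4 + 6 * c * m\<^sup>2 * s + 3 * s\<^sup>2"
    unfolding c_def \<alpha>2 by algebra
  then show "has_bochner_integral M (\<lambda>\<omega>. (C \<bullet> centered M X \<omega>) ^ 4)
      (c * (1 - 3 * c) * m ^ 4 + 6 * c * m\<^sup>2 * s + 3 * s\<^sup>2)"
    using has_bochner_integral_centered_power[OF sh(4)] by (simp only: m_def)
qed

lemma centered_transpose: "centered M (\<lambda>\<omega>. transpose (X \<omega>)) \<omega> = transpose (centered M X \<omega>)"
proof -
  let ?E = "\<alpha>1 *\<^sub>R T1 + \<alpha>2 *\<^sub>R T2"
  have "bounded_linear (\<lambda>Z. Z $ i $ j)" for i :: 'p and j :: 'q
    by (intro bounded_linear_compose[OF bounded_linear_vec_nth bounded_linear_vec_nth])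
  then have "has_bochner_integral M (\<lambda>\<omega>. X \<omega> $ i $ j) (?E $ i $ j)" for i j
    using has_bochner_integral_bounded_linear[OF _ has_bochner_integral_X_mean] by blast
  then have "has_bochner_integral M (\<lambda>\<omega>. transpose (X \<omega>)) (transpose ?E)"
    by (intro has_bochner_integral_matrix) (simp add: transpose_def)
  then show ?thesis
    using has_bochner_integral_X_mean
    by (simp add: centered_def has_bochner_integral_iff transpose_def vec_eq_iff)
qed

end

section \<open>The index of a normal mixture\<close>


text \<open>The index in whitened coordinates: the total covariance is the identity, hence the
  Gaussian part has covariance \<open>I - c \<delta> \<delta>'\<close>. The Gaussian pattern
  contributes 1 off and 3 on the diagonal, summing to \<open>q (q + 2)\<close>; the remaining
  coefficient \<open>c - 6 c\<^sup>2\<close> is the fourth cumulant.\<close>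

lemma sum_standardized_fourth_moments:
  fixes \<delta> :: "real^'q"
  assumes s: "\<And>j k. s j k = (if j = k then 1 else 0) - c * \<delta> $ j * \<delta> $ k"
  shows "(\<Sum>j\<in>UNIV. \<Sum>k\<in>UNIV. c * (1 - 3 * c) * (\<delta> $ j)\<^sup>2 * (\<delta> $ k)\<^sup>2
        + c * ((\<delta> $ j)\<^sup>2 * s k k + (\<delta> $ k)\<^sup>2 * s j j + 4 * (\<delta> $ j) * (\<delta> $ k) * s j k)
        + s j j * s k k + 2 * (s j k)\<^sup>2)
      = real CARD('q) * (real CARD('q) + 2) + c * (1 - 6 * c) * (\<delta> \<bullet> \<delta>)\<^sup>2"
    (is "(\<Sum>j\<in>UNIV. \<Sum>k\<in>UNIV. ?T j k) = _")
proof -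
  have "?T j k = 1 + (if j = k then 2 else 0) + c * (1 - 6 * c) * ((\<delta> $ j)\<^sup>2 * (\<delta> $ k)\<^sup>2)" for j k
    by (cases "j = k") (simp_all add: s power2_eq_square algebra_simps)
  then have "(\<Sum>j\<in>UNIV. \<Sum>k\<in>UNIV. ?T j k)
      = (\<Sum>j\<in>UNIV. \<Sum>k\<in>UNIV. 1 + (if j = k then 2 else 0) + c * (1 - 6 * c) * ((\<delta> $ j)\<^sup>2 * (\<delta> $ k)\<^sup>2))"
    by simp
  also have "(\<Sum>j\<in>UNIV. \<Sum>k\<in>UNIV. 1 + (if j = k then 2 else 0) + r * ((\<delta> $ j)\<^sup>2 * (\<delta> $ k)\<^sup>2))
      = real CARD('q) * (real CARD('q) + 2) + r * ((\<Sum>j\<in>UNIV. (\<delta> $ j)\<^sup>2) * (\<Sum>k\<in>UNIV. (\<delta> $ k)\<^sup>2))" for r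
    unfolding sum_product by (simp add: sum.distrib sum_distrib_left algebra_simps)
  finally show ?thesis by (simp add: inner_vec_def power2_eq_square)
qed

text \<open>Keeps of the distribution only the moments of linear forms, with the mixing weights
  entering through \<open>c\<close> and \<kappa>. Both the random matrix and its transpose satisfy
  these assumptions, so each result below can be used on either side.\<close>

locale mixture_moments = prob_space M for M :: "'a measure" +
  fixes X :: "'a \<Rightarrow> real^'q^'p" and D :: "real^'q^'p" and A :: "real^'p^'p" and B :: "real^'q^'q"
    and c \<kappa> :: real
  assumes c: "c > 0" and A: "pos_def_mat A" and B: "pos_def_mat B"
    and second: "\<And>C. has_bochner_integral M (\<lambda>\<omega>. (C \<bullet> centered M X \<omega>)\<^sup>2)
      (c * (C \<bullet> D)\<^sup>2 + C \<bullet> (A ** C ** B))"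
    and third: "\<And>C. has_bochner_integral M (\<lambda>\<omega>. (C \<bullet> centered M X \<omega>) ^ 3) (c * \<kappa> * (C \<bullet> D) ^ 3)"
    and fourth: "\<And>C. has_bochner_integral M (\<lambda>\<omega>. (C \<bullet> centered M X \<omega>) ^ 4)
      (c * (1 - 3 * c) * (C \<bullet> D) ^ 4 + 6 * c * (C \<bullet> D)\<^sup>2 * (C \<bullet> (A ** C ** B)) + 3 * (C \<bullet> (A ** C ** B))\<^sup>2)"
begin

abbreviation Y :: "'a \<Rightarrow> real^'q^'p" where "Y \<equiv> centered M X"

text \<open>Covariance of the Gaussian parts of two linear forms; the full covariance has the extra
  term \<open>c * (C1 \<bullet> D) * (C2 \<bullet> D)\<close>.\<close>

definition cov :: "real^'q^'p \<Rightarrow> real^'q^'p \<Rightarrow> real" where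
  "cov C1 C2 = C1 \<bullet> (A ** C2 ** B)"

lemma cov_commute: "cov C1 C2 = cov C2 C1"
proof -
  have "cov C1 C2 = (transpose A ** (C1 ** transpose B)) \<bullet> C2"
    unfolding cov_def by (simp only: inner_matrix_mult_right[of C1 "A ** C2"] inner_matrix_mult_left[of "C1 ** _"])
  also have "\<dots> = cov C2 C1"
    using A B by (simp add: cov_def inner_commute matrix_mul_assoc)
  finally show ?thesis .
qed

lemma cov_add_left: "cov (C1 + C2) C = cov C1 C + cov C2 C" and cov_diff_left: "cov (C1 - C2) C = cov C1 C - cov C2 C"
  by (simp_all add: cov_def inner_add_left inner_diff_left)

lemma cov_add_right: "cov C (C1 + C2) = cov C C1 + cov C C2" and cov_diff_right: "cov C (C1 - C2) = cov C C1 - cov C C2"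
  by (metis cov_add_left cov_commute) (metis cov_diff_left cov_commute)

lemmas cov_bilinear = cov_add_left cov_add_right cov_diff_left cov_diff_right

lemma mixed_second_moment:
  "has_bochner_integral M (\<lambda>\<omega>. (C1 \<bullet> Y \<omega>) * (C2 \<bullet> Y \<omega>)) (c * (C1 \<bullet> D) * (C2 \<bullet> D) + cov C1 C2)"
proof -
  have "has_bochner_integral M (\<lambda>\<omega>. (1/4) * (((C1 + C2) \<bullet> Y \<omega>)\<^sup>2 - ((C1 - C2) \<bullet> Y \<omega>)\<^sup>2))
    ((1/4) * ((c * ((C1 + C2) \<bullet> D)\<^sup>2 + cov (C1 + C2) (C1 + C2)) - (c * ((C1 - C2) \<bullet> D)\<^sup>2 + cov (C1 - C2) (C1 - C2))))"
    unfolding cov_def by (intro has_bochner_integral_mult_right has_bochner_integral_diff second)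
  moreover have Y: "(1/4) * (((C1 + C2) \<bullet> Z)\<^sup>2 - ((C1 - C2) \<bullet> Z)\<^sup>2) = (C1 \<bullet> Z) * (C2 \<bullet> Z)" for Z
    by (simp add: inner_add_left inner_diff_left power2_eq_square algebra_simps)
  moreover have E: "(1/4) * ((c * ((C1 + C2) \<bullet> D)\<^sup>2 + cov (C1 + C2) (C1 + C2)) - (c * ((C1 - C2) \<bullet> D)\<^sup>2 + cov (C1 - C2) (C1 - C2)))
     = c * (C1 \<bullet> D) * (C2 \<bullet> D) + cov C1 C2"
    using cov_commute[of C2 C1]
    by (simp add: cov_bilinear inner_add_left inner_diff_left power2_eq_square algebra_simps)
  ultimately show ?thesis by (simp only: Y E)
qed

text \<open>Polarization: \<open>(a + b)^4 + (a - b)^4 - 2 a^4 - 2 b^4 = 12 a\<^sup>2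
  b\<^sup>2\<close>, applied to the pure fourth moments.\<close>

lemma mixed_fourth_moment:
  "has_bochner_integral M (\<lambda>\<omega>. (C1 \<bullet> Y \<omega>)\<^sup>2 * (C2 \<bullet> Y \<omega>)\<^sup>2)
    (c * (1 - 3 * c) * (C1 \<bullet> D)\<^sup>2 * (C2 \<bullet> D)\<^sup>2
     + c * ((C1 \<bullet> D)\<^sup>2 * cov C2 C2 + (C2 \<bullet> D)\<^sup>2 * cov C1 C1 + 4 * (C1 \<bullet> D) * (C2 \<bullet> D) * cov C1 C2)
     + cov C1 C1 * cov C2 C2 + 2 * (cov C1 C2)\<^sup>2)"
proof -
  define m where "m C = c * (1 - 3 * c) * (C \<bullet> D) ^ 4 + 6 * c * (C \<bullet> D)\<^sup>2 * cov C C + 3 * (cov C C)\<^sup>2" for C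
  have "has_bochner_integral M
      (\<lambda>\<omega>. (1/12) * (((C1 + C2) \<bullet> Y \<omega>) ^ 4 + ((C1 - C2) \<bullet> Y \<omega>) ^ 4 - 2 * (C1 \<bullet> Y \<omega>) ^ 4 - 2 * (C2 \<bullet> Y \<omega>) ^ 4))
      ((1/12) * (m (C1 + C2) + m (C1 - C2) - 2 * m C1 - 2 * m C2))"
    unfolding m_def cov_def
    by (intro has_bochner_integral_mult_right has_bochner_integral_diff has_bochner_integral_add fourth)
  moreover have Y: "(1/12) * ((a + b) ^ 4 + (a - b) ^ 4 - 2 * a ^ 4 - 2 * b ^ 4) = a\<^sup>2 * b\<^sup>2" for a b :: real
    by (simp add: power2_eq_square power4_eq_xxxx algebra_simps)
  moreover have E: "(1/12) * (m (C1 + C2) + m (C1 - C2) - 2 * m C1 - 2 * m C2)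
    = c * (1 - 3 * c) * (C1 \<bullet> D)\<^sup>2 * (C2 \<bullet> D)\<^sup>2
     + c * ((C1 \<bullet> D)\<^sup>2 * cov C2 C2 + (C2 \<bullet> D)\<^sup>2 * cov C1 C1 + 4 * (C1 \<bullet> D) * (C2 \<bullet> D) * cov C1 C2)
     + cov C1 C1 * cov C2 C2 + 2 * (cov C1 C2)\<^sup>2"
    unfolding m_def cov_bilinear inner_add_left inner_diff_left cov_commute[of C2 C1]
    by (simp add: power2_eq_square power4_eq_xxxx algebra_simps)
  ultimately show ?thesis by (simp only: inner_add_left inner_diff_left Y E)
qed

lemma cov_outer_prod: "cov (outer_prod x y) (outer_prod x' y') = (x \<bullet> (A *v x')) * (y \<bullet> (B *v y'))"
  using B by (simp add: cov_def matrix_mult_outer_prod outer_prod_matrix_mult outer_prod_inner outer_prod_mult_vector inner_commute)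

lemma G1_eq: "G1 M X v = c *\<^sub>R outer_prod (D *v v) (D *v v) + (v \<bullet> (B *v v)) *\<^sub>R A"
proof -
  have "has_bochner_integral M (\<lambda>\<omega>. Y \<omega> ** outer_prod v v ** transpose (Y \<omega>))
      (c *\<^sub>R outer_prod (D *v v) (D *v v) + (v \<bullet> (B *v v)) *\<^sub>R A)"
  proof (rule has_bochner_integral_matrix)
    fix i j
    \<comment> \<open>Each entry is a product of two linear forms with rank-one coefficients, so
      \<open>mixed_second_moment\<close> gives its expectation.\<close>
    have "(Z ** outer_prod v v ** transpose Z) $ i $ j = (outer_prod (axis i 1) v \<bullet> Z) * (outer_prod (axis j 1) v \<bullet> Z)"
      for Z :: "real^'q^'p"
      by (simp add: matrix_mult_outer_prod outer_prod_matrix_mult outer_prod_inner inner_axis') (simp add: outer_prod_def)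
    then show "has_bochner_integral M (\<lambda>\<omega>. (Y \<omega> ** outer_prod v v ** transpose (Y \<omega>)) $ i $ j)
        ((c *\<^sub>R outer_prod (D *v v) (D *v v) + (v \<bullet> (B *v v)) *\<^sub>R A) $ i $ j)"
      using mixed_second_moment[of "outer_prod (axis i 1) v" "outer_prod (axis j 1) v"]
      by (simp add: cov_outer_prod outer_prod_inner inner_axis' matrix_vector_mult_basis column_def mult_ac)
        (simp add: outer_prod_def mult_ac)
  qed
  then show ?thesis by (simp add: G1_def has_bochner_integral_iff)
qed

lemma G2_eq: "G2 M X u = c *\<^sub>R outer_prod (transpose D *v u) (transpose D *v u) + (u \<bullet> (A *v u)) *\<^sub>R B"
proof -
  have "has_bochner_integral M (\<lambda>\<omega>. transpose (Y \<omega>) ** outer_prod u u ** Y \<omega>)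
      (c *\<^sub>R outer_prod (transpose D *v u) (transpose D *v u) + (u \<bullet> (A *v u)) *\<^sub>R B)"
  proof (rule has_bochner_integral_matrix)
    fix i j
    have comp: "u \<bullet> (Z *v axis i 1) = (transpose Z *v u) $ i" for Z :: "real^'q^'p" and i
      using inner_transpose_mult[of Z u "axis i 1"] by (simp add: inner_axis)
    have "(transpose Z ** outer_prod u u ** Z) $ i $ j = (outer_prod u (axis i 1) \<bullet> Z) * (outer_prod u (axis j 1) \<bullet> Z)"
      for Z :: "real^'q^'p"
      by (simp add: matrix_mult_outer_prod outer_prod_matrix_mult outer_prod_inner comp) (simp add: outer_prod_def)
    moreover have "axis i 1 \<bullet> (B *v axis j 1) = B $ i $ j"
      by (simp add: inner_axis' matrix_vector_mult_basis column_def)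
    ultimately show "has_bochner_integral M (\<lambda>\<omega>. (transpose (Y \<omega>) ** outer_prod u u ** Y \<omega>) $ i $ j)
        ((c *\<^sub>R outer_prod (transpose D *v u) (transpose D *v u) + (u \<bullet> (A *v u)) *\<^sub>R B) $ i $ j)"
      using mixed_second_moment[of "outer_prod u (axis i 1)" "outer_prod u (axis j 1)"]
      by (simp add: cov_outer_prod outer_prod_inner comp mult_ac)
        (simp add: outer_prod_def mult_ac)
  qed
  then show ?thesis by (simp add: G2_def has_bochner_integral_iff)
qed

lemma G2_mult: "G2 M X u *v w = (c * ((transpose D *v u) \<bullet> w)) *\<^sub>R (transpose D *v u) + (u \<bullet> (A *v u)) *\<^sub>R (B *v w)"
  by (simp add: G2_eq matrix_vector_mult_add_rdistrib scaleR_matrix_vector_assoc[symmetric] outer_prod_mult_vector)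

lemma pos_def_G2:
  assumes "u \<noteq> 0"
  shows "pos_def_mat (G2 M X u)"
  unfolding pos_def_mat_def
proof (intro conjI allI impI)
  have "transpose (outer_prod y y) = outer_prod y y" for y :: "real^'q"
    by (simp add: transpose_def outer_prod_def vec_eq_iff)
  moreover have "transpose (c *\<^sub>R P + r *\<^sub>R Q) = c *\<^sub>R transpose P + r *\<^sub>R transpose Q" for r and P Q :: "real^'q^'q"
    by (simp add: transpose_def vec_eq_iff)
  ultimately show "transpose (G2 M X u) = G2 M X u" using B by (simp add: G2_eq)
  fix w :: "real^'q" assume "w \<noteq> 0"
  then have "0 < (u \<bullet> (A *v u)) * (w \<bullet> (B *v w))" using A B assms by (simp add: pos_def_mat_def)
  moreover have "0 \<le> c * (((transpose D *v u) \<bullet> w) * (w \<bullet> (transpose D *v u)))"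
    using c by (simp add: inner_commute[of w])
  ultimately show "0 < w \<bullet> (G2 M X u *v w)"
    by (simp add: G2_mult inner_add_right mult.assoc)
qed

text \<open>Whiten with \<open>K\<close>, the inverse square root of \<open>G2\<close>: the
  quadratic form becomes a sum of squares of standardized linear forms, with standardized mean
  difference \<delta>. Since \<open>G2\<close> is a rank-one perturbation of \<open>a B\<close>, the
  squared length of \<delta> is explicit.\<close>

lemma psi_eq:
  assumes u: "u \<noteq> 0"
  defines "a \<equiv> u \<bullet> (A *v u)" and "\<rho> \<equiv> (transpose D *v u) \<bullet> (matrix_inv B *v (transpose D *v u))"
  shows "psi M X u = real CARD('q) * (real CARD('q) + 2) + c * (1 - 6 * c) * (\<rho> / (a + c * \<rho>))\<^sup>2"
proof -
  let ?G = "G2 M X u"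
  define L where "L = mat_sqrt ?G"
  define K where "K = matrix_inv L"
  note pG = pos_def_G2[OF u]
  have pL: "pos_def_mat L" and LL: "L ** L = ?G" using mat_sqrt[OF pG] by (simp_all add: L_def)
  have KL: "L ** K = mat 1" "K ** L = mat 1"
  proof -
    obtain N where N: "L ** N = mat 1" "N ** L = mat 1" using invertible_pos_def[OF pL] by (auto simp: invertible_def)
    then show "L ** K = mat 1" "K ** L = mat 1" using matrix_inv_unique[OF N(1)] by (simp_all add: K_def)
  qed
  have symK: "transpose K = K"
  proof -
    have "L ** transpose K = mat 1" using KL(2) pL by (metis matrix_transpose_mul pos_def_mat_transpose transpose_mat)
    then show ?thesis using matrix_inv_unique by (metis K_def)
  qed
  have invG: "matrix_inv ?G = K ** K"
  proof (rule matrix_inv_unique)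
    have "?G ** (K ** K) = L ** (L ** K) ** K" by (simp only: LL[symmetric] matrix_mul_assoc)
    then show "?G ** (K ** K) = mat 1" by (simp add: KL)
  qed
  define C where "C j = outer_prod u (K *v axis j 1)" for j
  define \<delta> where "\<delta> = K *v (transpose D *v u)"
  have C_inner: "C j \<bullet> Z = (K *v (transpose Z *v u)) $ j" for j and Z :: "real^'q^'p"
  proof -
    have "C j \<bullet> Z = (transpose Z *v u) \<bullet> (K *v axis j 1)"
      by (simp add: C_def outer_prod_inner inner_transpose_mult)
    also have "\<dots> = (K *v (transpose Z *v u)) \<bullet> axis j 1"
      by (rule symmetric_mat_inner[OF symK, symmetric])
    finally show ?thesis by (simp add: inner_axis)
  qed
  \<comment> \<open>This is \<open>K G K = I\<close> read entrywise, with the rank-one part of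
    \<open>G\<close> moved to the right-hand side.\<close>
  have cov_C: "cov (C j) (C k) = (if j = k then 1 else 0) - c * \<delta> $ j * \<delta> $ k" for j k
  proof -
    let ?w = "K *v axis k (1::real)"
    have "K *v (?G *v ?w) = (K ** L) *v ((L ** K) *v axis k 1)"
      by (simp add: LL[symmetric] matrix_vector_mul_assoc[symmetric])
    then have "axis j 1 \<bullet> (K *v (?G *v ?w)) = (if j = k then 1 else 0)"
      by (simp add: KL inner_axis_axis)
    moreover have "axis j 1 \<bullet> (K *v (?G *v ?w)) = (K *v axis j 1) \<bullet> (?G *v ?w)"
      by (rule symmetric_mat_inner[OF symK, symmetric])
    moreover have "(transpose D *v u) \<bullet> (K *v axis i 1) = \<delta> $ i" for i
      using C_inner[of i D] by (simp add: C_def outer_prod_inner inner_transpose_mult \<delta>_def)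
    ultimately show ?thesis
      unfolding C_def cov_outer_prod G2_mult by (simp add: inner_add_right inner_commute mult_ac)
  qed
  have "u \<bullet> ((Z ** matrix_inv ?G ** transpose Z) *v u) = (\<Sum>j\<in>UNIV. (C j \<bullet> Z)\<^sup>2)" for Z :: "real^'q^'p"
  proof -
    let ?z = "transpose Z *v u"
    have "u \<bullet> ((Z ** matrix_inv ?G ** transpose Z) *v u) = u \<bullet> (Z *v (K *v (K *v ?z)))"
      by (simp add: invG matrix_vector_mul_assoc[symmetric])
    also have "\<dots> = (K *v ?z) \<bullet> (K *v ?z)"
      unfolding inner_transpose_mult[of Z u, symmetric] by (rule symmetric_mat_inner[OF symK, symmetric])
    also have "\<dots> = (\<Sum>j\<in>UNIV. ((K *v ?z) $ j)\<^sup>2)" by (simp add: inner_vec_def power2_eq_square)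
    finally show ?thesis by (simp add: C_inner)
  qed
  then have sq: "(u \<bullet> ((Z ** matrix_inv ?G ** transpose Z) *v u))\<^sup>2
      = (\<Sum>j\<in>UNIV. \<Sum>k\<in>UNIV. (C j \<bullet> Z)\<^sup>2 * (C k \<bullet> Z)\<^sup>2)" for Z :: "real^'q^'p"
    by (simp add: power2_eq_square[of "sum _ _"] sum_product)
  have "has_bochner_integral M (\<lambda>\<omega>. (u \<bullet> ((Y \<omega> ** matrix_inv ?G ** transpose (Y \<omega>)) *v u))\<^sup>2)
    (\<Sum>j\<in>UNIV. \<Sum>k\<in>UNIV. c * (1 - 3 * c) * (\<delta> $ j)\<^sup>2 * (\<delta> $ k)\<^sup>2
        + c * ((\<delta> $ j)\<^sup>2 * cov (C k) (C k) + (\<delta> $ k)\<^sup>2 * cov (C j) (C j) + 4 * (\<delta> $ j) * (\<delta> $ k) * cov (C j) (C k))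
        + cov (C j) (C j) * cov (C k) (C k) + 2 * (cov (C j) (C k))\<^sup>2)"
    unfolding sq using mixed_fourth_moment[of "C _" "C _"]
    by (intro has_bochner_integral_sum) (simp add: \<delta>_def C_inner[of _ D])
  then have psi: "psi M X u = real CARD('q) * (real CARD('q) + 2) + c * (1 - 6 * c) * (\<delta> \<bullet> \<delta>)\<^sup>2"
    unfolding sum_standardized_fourth_moments[OF cov_C] by (simp add: psi_def has_bochner_integral_iff)
  let ?y = "transpose D *v u"
  have Binv: "B *v (matrix_inv B *v y) = y" for y
  proof -
    obtain N where "B ** N = mat 1" using invertible_pos_def[OF B] by (auto simp: invertible_def)
    then have "B ** matrix_inv B = mat 1" using matrix_inv_unique by metis
    then show ?thesis by (simp add: matrix_vector_mul_assoc)
  qed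
  have apos: "a > 0" using A u by (simp add: a_def pos_def_mat_def)
  have rho: "\<rho> \<ge> 0"
  proof -
    have "\<rho> = (matrix_inv B *v ?y) \<bullet> (B *v (matrix_inv B *v ?y))" by (simp add: Binv \<rho>_def inner_commute)
    then show ?thesis using B unfolding pos_def_mat_def by (metis inner_zero_left less_eq_real_def)
  qed
  have "K *v (K *v ?y) = (1 / (a + c * \<rho>)) *\<^sub>R (matrix_inv B *v ?y)"
  proof -
    \<comment> \<open>Sherman-Morrison: \<open>G\<close> sends \<open>B\<^sup>-\<^sup>1 D'u\<close>
      to \<open>a + c \<rho>\<close> times \<open>D'u\<close>, so dividing by this factor gives the
      preimage.\<close>
    let ?z = "(1 / (a + c * \<rho>)) *\<^sub>R (matrix_inv B *v ?y)"
    have pos: "a + c * \<rho> > 0" using apos rho c by (simp add: add_pos_nonneg)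
    have "?G *v ?z = ((c * \<rho>) / (a + c * \<rho>) + a / (a + c * \<rho>)) *\<^sub>R ?y"
      by (simp add: G2_mult matrix_vector_mult_scaleR Binv \<rho>_def[symmetric] a_def[symmetric] scaleR_add_left scaleR_add_right)
    also have "(c * \<rho>) / (a + c * \<rho>) + a / (a + c * \<rho>) = 1"
      using pos by (simp add: add_divide_distrib[symmetric])
    finally have "?y = ?G *v ?z" by simp
    then have "K *v (K *v ?y) = K *v (K *v (?G *v ?z))" by (rule arg_cong)
    also have "\<dots> = (K ** (K ** L) ** L) *v ?z"
      by (simp only: LL[symmetric] matrix_vector_mul_assoc matrix_mul_assoc)
    finally show ?thesis by (simp add: KL)
  qed
  then have "\<delta> \<bullet> \<delta> = \<rho> / (a + c * \<rho>)"
    by (simp add: \<delta>_def symmetric_mat_inner[OF symK] \<rho>_def)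
  then show ?thesis using psi by simp
qed

lemma bilin_moment_eq:
  "bilin_moment M X 2 u v = c * (u \<bullet> (D *v v))\<^sup>2 + (u \<bullet> (A *v u)) * (v \<bullet> (B *v v))"
  "bilin_moment M X 3 u v = c * \<kappa> * (u \<bullet> (D *v v)) ^ 3"
  using second[of "outer_prod u v"] third[of "outer_prod u v"] cov_outer_prod[of u v u v]
  by (simp_all add: bilin_moment_def outer_prod_inner has_bochner_integral_iff cov_def)

end

section \<open>Optimizers\<close>


lemma pos_def_sqrt_facts:
  assumes "pos_def_mat N"
  shows mat_sqrt_inv_left: "matrix_inv (mat_sqrt N) ** mat_sqrt N = mat 1"
    and mat_sqrt_inv_right: "mat_sqrt N ** matrix_inv (mat_sqrt N) = mat 1"
    and matrix_inv_pos_def: "matrix_inv N = matrix_inv (mat_sqrt N) ** matrix_inv (mat_sqrt N)"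
    and transpose_mat_sqrt: "transpose (mat_sqrt N) = mat_sqrt N"
    and transpose_matrix_inv_mat_sqrt: "transpose (matrix_inv (mat_sqrt N)) = matrix_inv (mat_sqrt N)"
    and inner_mat_sqrt: "x \<bullet> (N *v x) = (norm (mat_sqrt N *v x))\<^sup>2"
    and mat_sqrt_mult_zero_iff: "mat_sqrt N *v x = 0 \<longleftrightarrow> x = 0"
    and inner_matrix_inv: "x \<bullet> (matrix_inv N *v x) = (norm (matrix_inv (mat_sqrt N) *v x))\<^sup>2"
proof -
  let ?S = "mat_sqrt N"
  have pS: "pos_def_mat ?S" and SS: "?S ** ?S = N" using mat_sqrt[OF assms] by auto
  obtain L where L: "?S ** L = mat 1" "L ** ?S = mat 1"
    using invertible_pos_def[OF pS] by (auto simp: invertible_def)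
  then have inv: "matrix_inv ?S = L" using matrix_inv_unique by blast
  show "matrix_inv ?S ** ?S = mat 1" "?S ** matrix_inv ?S = mat 1" using L inv by auto
  have "(?S ** ?S) ** (L ** L) = ?S ** (?S ** L) ** L" by (simp only: matrix_mul_assoc)
  then have "N ** (L ** L) = mat 1" by (simp add: L SS)
  then show NL: "matrix_inv N = matrix_inv ?S ** matrix_inv ?S" by (simp add: inv matrix_inv_unique)
  show tS: "transpose ?S = ?S" using pS by simp
  have "?S ** transpose L = mat 1" using L(2) by (metis matrix_transpose_mul tS transpose_mat)
  then show tL: "transpose (matrix_inv ?S) = matrix_inv ?S" using matrix_inv_unique inv by metis
  show "x \<bullet> (N *v x) = (norm (?S *v x))\<^sup>2"
    by (simp add: power2_norm_eq_inner symmetric_mat_inner[OF tS] matrix_vector_mul_assoc SS)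
  show "?S *v x = 0 \<longleftrightarrow> x = 0" by (rule pos_def_mat_mult_zero_iff[OF pS])
  show "x \<bullet> (matrix_inv N *v x) = (norm (matrix_inv ?S *v x))\<^sup>2"
    by (simp add: power2_norm_eq_inner symmetric_mat_inner[OF tL] matrix_vector_mul_assoc NL)
qed

text \<open>After cross-multiplication the terms \<open>c \<rho> \<sigma>\<close> cancel and the
  hypothesis remains; squaring keeps the order as the left quotient is nonnegative.\<close>

lemma standardized_ratio_square_strict_mono:
  fixes a b \<rho> \<sigma> c :: real
  assumes "c > 0" "a > 0" "b > 0" "0 \<le> \<rho>" "\<rho> / a < \<sigma> / b"
  shows "(\<rho> / (a + c * \<rho>))\<^sup>2 < (\<sigma> / (b + c * \<sigma>))\<^sup>2"
proof -
  have lt: "\<rho> * b < \<sigma> * a" using assms by (simp add: field_simps)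
  then have "0 < \<sigma> * a" using assms by (smt (verit) mult_nonneg_nonneg)
  then have s: "0 < \<sigma>" using assms by (simp add: zero_less_mult_iff)
  have "0 < a + c * \<rho>" "0 < b + c * \<sigma>" using assms s by (simp_all add: add_pos_nonneg)
  moreover have "\<rho> * (b + c * \<sigma>) < \<sigma> * (a + c * \<rho>)" using lt by (simp add: algebra_simps)
  ultimately have "\<rho> / (a + c * \<rho>) < \<sigma> / (b + c * \<sigma>)" by (simp add: divide_less_eq less_divide_eq mult.commute field_simps)
  moreover have "0 \<le> \<rho> / (a + c * \<rho>)" using assms by simp
  ultimately show ?thesis by (intro power_strict_mono) auto
qed

context mixture_moments
begin

abbreviation S where "S \<equiv> mat_sqrt A"
abbreviation R where "R \<equiv> mat_sqrt B"
abbreviation H where "H \<equiv> matrix_inv S ** D ** matrix_inv R"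

section \<open>Standardized coordinates and the Rayleigh quotients\<close>

lemma D_eq: "D = S ** H ** R"
proof -
  have "S ** H ** R = (S ** matrix_inv S) ** D ** (matrix_inv R ** R)" by (simp only: matrix_mul_assoc)
  then show ?thesis by (simp add: mat_sqrt_inv_right[OF A] mat_sqrt_inv_left[OF B])
qed

lemma D_mult: "D *v v = S *v (H *v (R *v v))"
proof -
  have "D *v v = (S ** H ** R) *v v" by (simp only: D_eq[symmetric])
  then show ?thesis by (simp only: matrix_vector_mul_assoc[symmetric])
qed

lemma transpose_D_mult: "transpose D *v u = R *v (transpose H *v (S *v u))"
proof -
  have eq: "transpose D = R ** transpose H ** S"
    by (subst D_eq) (simp only: matrix_transpose_mul transpose_mat_sqrt[OF A] transpose_mat_sqrt[OF B] matrix_mul_assoc)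
  show ?thesis unfolding eq by (simp only: matrix_vector_mul_assoc[symmetric])
qed

lemma rank_H: "rank H = rank D"
proof (rule antisym)
  show "rank H \<le> rank D" by (metis le_trans rank_mul_le_left rank_mul_le_right)
  show "rank D \<le> rank H" by (subst D_eq) (metis le_trans rank_mul_le_left rank_mul_le_right)
qed

text \<open>The Rayleigh quotient of \<open>HH'\<close> at \<open>S u\<close>, written \<eta> in the
  overview.\<close>

definition ratio :: "real^'p \<Rightarrow> real" where
  "ratio u = (norm (transpose H *v (S *v u)))\<^sup>2 / (norm (S *v u))\<^sup>2"

lemma norm_S_pos: "u \<noteq> 0 \<Longrightarrow> norm (S *v u) > 0"
  by (simp add: mat_sqrt_mult_zero_iff[OF A])

lemma norm_R_pos: "v \<noteq> 0 \<Longrightarrow> norm (R *v v) > 0"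
  by (simp add: mat_sqrt_mult_zero_iff[OF B])

lemma psi_eq_singular:
  assumes "u \<noteq> 0"
  shows "psi M X u = real CARD('q) * (real CARD('q) + 2) + c * (1 - 6 * c) *
    ((norm (transpose H *v (S *v u)))\<^sup>2 / ((norm (S *v u))\<^sup>2 + c * (norm (transpose H *v (S *v u)))\<^sup>2))\<^sup>2"
  using psi_eq[OF assms]
  by (simp add: inner_mat_sqrt[OF A] inner_matrix_inv[OF B] transpose_D_mult matrix_vector_mul_assoc[of "matrix_inv R" R]
      mat_sqrt_inv_left[OF B])

lemma psi_strict_mono_ratio:
  assumes "u \<noteq> 0" "w \<noteq> 0" "ratio u < ratio w"
  shows "c * (1 - 6 * c) > 0 \<Longrightarrow> psi M X u < psi M X w"
    and "c * (1 - 6 * c) < 0 \<Longrightarrow> psi M X w < psi M X u"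
  using standardized_ratio_square_strict_mono[OF c, of "(norm (S *v u))\<^sup>2" "(norm (S *v w))\<^sup>2"
      "(norm (transpose H *v (S *v u)))\<^sup>2" "(norm (transpose H *v (S *v w)))\<^sup>2"]
    norm_S_pos[OF assms(1)] norm_S_pos[OF assms(2)] assms(3)
  by (simp_all add: psi_eq_singular assms ratio_def mult_strict_left_mono mult_strict_left_mono_neg)

text \<open>A feasible vector with larger \<open>ratio\<close> would strictly improve the index in
  the relevant direction. The predicate \<open>P\<close> is general so that it can be any stage of
  the constrained problem.\<close>

lemma ratio_le_of_optimal_psi:
  assumes "u \<noteq> 0" and "\<And>w. P w \<Longrightarrow> w \<noteq> 0" and "P w"
    and "c * (1 - 6 * c) < 0 \<and> is_arg_min (psi M X) P u \<or> c * (1 - 6 * c) > 0 \<and> is_arg_max (psi M X) P u"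
  shows "ratio w \<le> ratio u"
proof (rule ccontr)
  assume "\<not> ?thesis"
  then have less: "ratio u < ratio w" by simp
  have "w \<noteq> 0" using assms by blast
  from psi_strict_mono_ratio[OF assms(1) this less] assms(3,4) show False
    by (auto simp: is_arg_min_def is_arg_max_def)
qed

text \<open>The \<open>ratio\<close> of the transposed problem, restated here so that both members
  of a pair can be treated in one locale.\<close>

definition coratio :: "real^'q \<Rightarrow> real" where
  "coratio v = (norm (H *v (R *v v)))\<^sup>2 / (norm (R *v v))\<^sup>2"

text \<open>On a singular pair, \<open>D v\<close> and \<open>S (S u)\<close> are both multiples of
  \<open>S x\<close>, so both summands of \<open>G1\<close> send \<open>u\<close> into that line. As
  \<open>1 + c t\<^sup>2\<close> is positive, for nonzero \<open>a\<close> and \<open>b\<close> the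
  constraint says exactly that \<open>S w\<close> is orthogonal to \<open>x\<close>.\<close>

lemma G1_pair_inner:
  assumes "H *v y = t *\<^sub>R x" and "S *v u = a *\<^sub>R x" "R *v v = b *\<^sub>R y" and "norm x = 1" "norm y = 1"
  shows "w \<bullet> (G1 M X v *v u) = a * b\<^sup>2 * (1 + c * t\<^sup>2) * ((S *v w) \<bullet> x)"
proof -
  have Dv: "D *v v = (b * t) *\<^sub>R (S *v x)" by (simp add: D_mult assms matrix_vector_mult_scaleR)
  have vv: "v \<bullet> (B *v v) = b\<^sup>2" using assms(5) by (simp add: inner_mat_sqrt[OF B] assms(3))
  have Sw: "w \<bullet> (S *v z) = (S *v w) \<bullet> z" for w z
    by (rule symmetric_mat_inner[OF transpose_mat_sqrt[OF A], symmetric])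
  have Au: "A *v u = S *v (S *v u)" by (simp add: matrix_vector_mul_assoc mat_sqrt_mult[OF A])
  have "x \<bullet> x = 1" using assms(4) by (simp add: norm_eq_1)
  then show ?thesis
    by (simp add: G1_eq matrix_vector_mult_add_rdistrib scaleR_matrix_vector_assoc[symmetric] outer_prod_mult_vector Dv vv
        inner_add_right Sw Au assms(2) inner_commute[of _ u] matrix_vector_mult_scaleR)
      (simp add: Sw inner_commute[of u] assms(2) power2_eq_square algebra_simps)
qed

lemma G2_pair_inner:
  assumes "transpose H *v x = t *\<^sub>R y" and "S *v u = a *\<^sub>R x" "R *v v = b *\<^sub>R y" and "norm x = 1" "norm y = 1"
  shows "w \<bullet> (G2 M X u *v v) = b * a\<^sup>2 * (1 + c * t\<^sup>2) * ((R *v w) \<bullet> y)"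
proof -
  have Dv: "transpose D *v u = (a * t) *\<^sub>R (R *v y)" by (simp add: transpose_D_mult assms matrix_vector_mult_scaleR)
  have vv: "u \<bullet> (A *v u) = a\<^sup>2" using assms(4) by (simp add: inner_mat_sqrt[OF A] assms(2))
  have Sw: "w \<bullet> (R *v z) = (R *v w) \<bullet> z" for w z
    by (rule symmetric_mat_inner[OF transpose_mat_sqrt[OF B], symmetric])
  have Au: "B *v v = R *v (R *v v)" by (simp add: matrix_vector_mul_assoc mat_sqrt_mult[OF B])
  have "y \<bullet> y = 1" using assms(5) by (simp add: norm_eq_1)
  then show ?thesis
    by (simp add: G2_eq matrix_vector_mult_add_rdistrib scaleR_matrix_vector_assoc[symmetric] outer_prod_mult_vector Dv vv
        inner_add_right Sw Au assms(3) inner_commute[of _ v] matrix_vector_mult_scaleR)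
      (simp add: Sw inner_commute[of v] assms(3) power2_eq_square algebra_simps)
qed

end

text \<open>The constraints normalize \<open>u\<close>, the singular value problem normalizes
  \<open>S u\<close>. Since the quotients ignore scaling, it suffices that a unit \<open>u\<close>
  reaches every direction \<open>z\<close>.\<close>

lemma exists_unit_with_image_direction:
  fixes N L :: "real^'n^'n"
  assumes "N ** L = mat 1" and "norm z = 1"
  obtains u r where "norm u = 1" "r > 0" "N *v u = r *\<^sub>R z"
proof
  have z: "N *v (L *v z) = z" by (simp add: matrix_vector_mul_assoc assms(1))
  then have "L *v z \<noteq> 0" using assms(2) by auto
  then show "norm ((1 / norm (L *v z)) *\<^sub>R (L *v z)) = 1" "1 / norm (L *v z) > 0" by simp_all
  show "N *v ((1 / norm (L *v z)) *\<^sub>R (L *v z)) = (1 / norm (L *v z)) *\<^sub>R z"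
    by (simp add: matrix_vector_mult_scaleR z)
qed

context mixture_moments
begin

text \<open>Strong induction: at stage \<open>j\<close> the constraint matrices depend on all
  earlier partners, and only the knowledge that these form singular pairs turns the constraints into
  orthogonality.\<close>

lemma ratio_optimizers_singular_pairs:
  fixes u :: "nat \<Rightarrow> real^'p" and v :: "nat \<Rightarrow> real^'q" and d :: nat
  defines "x \<equiv> \<lambda>j. (1 / norm (S *v u j)) *\<^sub>R (S *v u j)" and "y \<equiv> \<lambda>j. (1 / norm (R *v v j)) *\<^sub>R (R *v v j)"
  assumes dist: "distinct_nonzero_singular_values H" and d: "d \<le> rank H"
    and fu: "\<And>j. j \<in> {1..d} \<Longrightarrow> feasible1 M X u v j (u j)" and fv: "\<And>j. j \<in> {1..d} \<Longrightarrow> feasible2 M X u v j (v j)"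
    and maxu: "\<And>j w. j \<in> {1..d} \<Longrightarrow> feasible1 M X u v j w \<Longrightarrow> ratio w \<le> ratio (u j)"
    and maxv: "\<And>j w. j \<in> {1..d} \<Longrightarrow> feasible2 M X u v j w \<Longrightarrow> coratio w \<le> coratio (v j)"
    and j: "j \<in> {1..d}"
  shows "(\<exists>t. t \<noteq> 0 \<and> H *v y j = t *\<^sub>R x j \<and> transpose H *v x j = t *\<^sub>R y j)
    \<and> (\<forall>k\<in>{1..<j}. x j \<bullet> x k = 0 \<and> y j \<bullet> y k = 0)"
  using j
proof (induction j rule: less_induct)
  case (less j)
  have sub: "k \<in> {1..d}" if "k \<in> {1..<j}" for k using that less.prems by auto
  have u0: "u k \<noteq> 0" and v0: "v k \<noteq> 0" if "k \<in> {1..d}" for k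
    using fu[OF that] fv[OF that] by (auto simp: feasible1_def feasible2_def)
  have nx: "norm (x k) = 1" and ny: "norm (y k) = 1"
    and Su: "S *v u k = norm (S *v u k) *\<^sub>R x k" and Rv: "R *v v k = norm (R *v v k) *\<^sub>R y k"
    if "k \<in> {1..d}" for k
    using norm_S_pos[OF u0[OF that]] norm_R_pos[OF v0[OF that]] by (simp_all add: x_def y_def)
  obtain t where t: "\<And>k. k \<in> {1..<j} \<Longrightarrow> H *v y k = t k *\<^sub>R x k" "\<And>k. k \<in> {1..<j} \<Longrightarrow> transpose H *v x k = t k *\<^sub>R y k"
    using less.IH sub by (metis atLeastLessThan_iff)
  have pos: "1 + c * r\<^sup>2 \<noteq> 0" for r using c by (smt (verit) mult_nonneg_nonneg zero_le_power2)
  have f1: "feasible1 M X u v j w \<longleftrightarrow> norm w = 1 \<and> (\<forall>k\<in>{1..<j}. (S *v w) \<bullet> x k = 0)" for w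
  proof -
    have "w \<bullet> (G1 M X (v k) *v u k) = 0 \<longleftrightarrow> (S *v w) \<bullet> x k = 0" if k: "k \<in> {1..<j}" for k
      using G1_pair_inner[OF t(1)[OF k] Su Rv nx ny, OF sub[OF k] sub[OF k] sub[OF k] sub[OF k], where w = w] pos[of "t k"]
        norm_S_pos[OF u0[OF sub[OF k]]] norm_R_pos[OF v0[OF sub[OF k]]] by simp
    then show ?thesis by (simp add: feasible1_def)
  qed
  have f2: "feasible2 M X u v j w \<longleftrightarrow> norm w = 1 \<and> (\<forall>k\<in>{1..<j}. (R *v w) \<bullet> y k = 0)" for w
  proof -
    have "w \<bullet> (G2 M X (u k) *v v k) = 0 \<longleftrightarrow> (R *v w) \<bullet> y k = 0" if k: "k \<in> {1..<j}" for k
      using G2_pair_inner[OF t(2)[OF k] Su Rv nx ny, OF sub[OF k] sub[OF k] sub[OF k] sub[OF k], where w = w] pos[of "t k"]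
        norm_S_pos[OF u0[OF sub[OF k]]] norm_R_pos[OF v0[OF sub[OF k]]] by simp
    then show ?thesis by (simp add: feasible2_def)
  qed
  have orthx: "x j \<bullet> x k = 0" and orthy: "y j \<bullet> y k = 0" if "k \<in> {1..<j}" for k
    using fu[OF less.prems] fv[OF less.prems] that by (auto simp: f1 f2 x_def y_def)
  have "\<exists>t. t \<noteq> 0 \<and> H *v y j = t *\<^sub>R x j \<and> transpose H *v x j = t *\<^sub>R y j"
  proof (rule maximizers_form_singular_pair[OF dist, of "{1..<j}"])
    \<comment> \<open>Only \<open>j - 1\<close> vectors precede stage \<open>j\<close>, and
      \<open>j \<le> d \<le> rank H\<close>; so a nonzero singular value is still left.\<close>
    show "card {1..<j} < rank H" using less.prems d by auto
    show "norm (transpose H *v z) \<le> norm (transpose H *v x j)"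
      if z: "norm z = 1" "\<And>k. k \<in> {1..<j} \<Longrightarrow> z \<bullet> x k = 0" for z
    proof -
      obtain w r where w: "norm w = 1" "r > 0" "S *v w = r *\<^sub>R z"
        using exists_unit_with_image_direction[OF mat_sqrt_inv_right[OF A] z(1)] by metis
      then have "ratio w \<le> ratio (u j)" using z by (intro maxu less.prems) (simp add: f1)
      moreover have "ratio w = (norm (transpose H *v z))\<^sup>2"
        using w z by (simp add: ratio_def matrix_vector_mult_scaleR power_mult_distrib)
      moreover have "ratio (u j) = (norm (transpose H *v x j))\<^sup>2"
        by (simp add: ratio_def x_def matrix_vector_mult_scaleR power_divide)
      ultimately show ?thesis by simp
    qed
    show "norm (H *v z) \<le> norm (H *v y j)"
      if z: "norm z = 1" "\<And>k. k \<in> {1..<j} \<Longrightarrow> z \<bullet> y k = 0" for z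
    proof -
      obtain w r where w: "norm w = 1" "r > 0" "R *v w = r *\<^sub>R z"
        using exists_unit_with_image_direction[OF mat_sqrt_inv_right[OF B] z(1)] by metis
      then have "coratio w \<le> coratio (v j)" using z by (intro maxv less.prems) (simp add: f2)
      moreover have "coratio w = (norm (H *v z))\<^sup>2"
        using w z by (simp add: coratio_def matrix_vector_mult_scaleR power_mult_distrib)
      moreover have "coratio (v j) = (norm (H *v y j))\<^sup>2"
        by (simp add: coratio_def y_def matrix_vector_mult_scaleR power_divide)
      ultimately show ?thesis by simp
    qed
  qed (use t nx[OF less.prems] ny[OF less.prems] orthx orthy in auto)
  with orthx orthy show ?case by blast
qed

text \<open>Multiplying the candidate by \<open>S\<close> and \<open>R\<close> turns its terms into
  those of the expansion of \<open>H\<close>; undoing the two factors gives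
  \<open>S\<^sup>-\<^sup>1 H R\<^sup>-\<^sup>1\<close>, which is the claimed product.\<close>

lemma sum_outer_prod_eq_inv_D_inv:
  assumes "H = (\<Sum>j\<in>J. \<tau> j *\<^sub>R outer_prod (x j) (y j))"
    and "\<And>j. j \<in> J \<Longrightarrow> S *v u j = a j *\<^sub>R x j" "\<And>j. j \<in> J \<Longrightarrow> R *v v j = b j *\<^sub>R y j"
    and "\<And>j. j \<in> J \<Longrightarrow> a j \<noteq> 0" "\<And>j. j \<in> J \<Longrightarrow> b j \<noteq> 0"
  shows "(\<Sum>j\<in>J. (\<tau> j / (a j * b j)) *\<^sub>R outer_prod (u j) (v j)) = matrix_inv A ** D ** matrix_inv B"
proof -
  let ?W = "\<Sum>j\<in>J. (\<tau> j / (a j * b j)) *\<^sub>R outer_prod (u j) (v j)"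
  have lin: "linear (\<lambda>Z. S ** Z ** R)"
    by (rule linearI) (simp_all add: vec_eq_iff matrix_matrix_mult_def sum_distrib_left sum_distrib_right sum.distrib algebra_simps)
  have "S ** ?W ** R = (\<Sum>j\<in>J. (\<tau> j / (a j * b j)) *\<^sub>R (S ** outer_prod (u j) (v j) ** R))"
    by (simp add: linear_sum[OF lin] linear_scale[OF lin])
  also have "\<dots> = (\<Sum>j\<in>J. \<tau> j *\<^sub>R outer_prod (x j) (y j))"
  proof (intro sum.cong refl)
    fix j assume j: "j \<in> J"
    have "S ** outer_prod (u j) (v j) ** R = outer_prod (a j *\<^sub>R x j) (b j *\<^sub>R y j)"
      by (simp add: matrix_mult_outer_prod outer_prod_matrix_mult transpose_mat_sqrt[OF B] assms(2,3) j)
    also have "\<dots> = (a j * b j) *\<^sub>R outer_prod (x j) (y j)"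
      by (simp add: outer_prod_def vec_eq_iff)
    finally show "(\<tau> j / (a j * b j)) *\<^sub>R (S ** outer_prod (u j) (v j) ** R) = \<tau> j *\<^sub>R outer_prod (x j) (y j)"
      using assms(4,5)[OF j] by simp
  qed
  finally have W: "S ** ?W ** R = H" by (simp only: assms(1)[symmetric])
  have "?W = (matrix_inv S ** S) ** ?W ** (R ** matrix_inv R)"
    by (simp add: mat_sqrt_inv_left[OF A] mat_sqrt_inv_right[OF B])
  also have "\<dots> = matrix_inv S ** (S ** ?W ** R) ** matrix_inv R" by (simp only: matrix_mul_assoc)
  also have "\<dots> = matrix_inv A ** D ** matrix_inv B"
    unfolding W matrix_inv_pos_def[OF A] matrix_inv_pos_def[OF B] by (simp only: matrix_mul_assoc)
  finally show ?thesis .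
qed

text \<open>Inverts the index: \<open>theta\<close> recovers
  \<open>t\<^sup>2 / (1 + c t\<^sup>2)\<close>, and \<open>\<theta> / (1 - c \<theta>)\<close> then
  equals \<open>t\<^sup>2\<close>. Both arguments of \<open>max\<close> are nonnegative here, so the
  truncation at 0 has no effect.\<close>

lemma lam_of_singular_pair:
  assumes c_def: "c = \<alpha>1 * \<alpha>2" and "1 - 6 * c \<noteq> 0" and u: "u \<noteq> 0"
    and "S *v u = a *\<^sub>R x" "transpose H *v x = t *\<^sub>R y" "norm x = 1" "norm y = 1"
  shows "lam M X \<alpha>1 \<alpha>2 u = \<bar>t\<bar>"
proof -
  have a: "a \<noteq> 0" using norm_S_pos[OF u] assms(4) by auto
  have pos: "1 + c * t\<^sup>2 > 0" using c by (simp add: add_pos_nonneg)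
  have "(a * t)\<^sup>2 / (a\<^sup>2 + c * (a * t)\<^sup>2) = t\<^sup>2 / (1 + c * t\<^sup>2)"
  proof -
    have "a\<^sup>2 + c * (a * t)\<^sup>2 = a\<^sup>2 * (1 + c * t\<^sup>2)" by (simp add: power_mult_distrib algebra_simps)
    then show ?thesis using a by (simp add: power_mult_distrib)
  qed
  then have "psi M X u = real CARD('q) * (real CARD('q) + 2) + c * (1 - 6 * c) * (t\<^sup>2 / (1 + c * t\<^sup>2))\<^sup>2"
    using psi_eq_singular[OF u] assms(4-7) by (simp add: matrix_vector_mult_scaleR power_mult_distrib)
  moreover have "\<alpha>1 * \<alpha>2 * (1 - 6 * \<alpha>1 * \<alpha>2) = c * (1 - 6 * c)" by (simp add: c_def)
  moreover have "c * (1 - 6 * c) \<noteq> 0" using assms(2) c by simp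
  ultimately have "(psi M X u - real CARD('q) * (real CARD('q) + 2)) / (\<alpha>1 * \<alpha>2 * (1 - 6 * \<alpha>1 * \<alpha>2)) = (t\<^sup>2 / (1 + c * t\<^sup>2))\<^sup>2"
    by (metis add_diff_cancel_left' nonzero_mult_div_cancel_left)
  then have th: "theta M X \<alpha>1 \<alpha>2 u = t\<^sup>2 / (1 + c * t\<^sup>2)"
    using pos by (simp add: theta_def)
  have "1 - c * (t\<^sup>2 / (1 + c * t\<^sup>2)) = 1 / (1 + c * t\<^sup>2)" using pos by (simp add: field_simps)
  then have "t\<^sup>2 / (1 + c * t\<^sup>2) / (1 - c * (t\<^sup>2 / (1 + c * t\<^sup>2))) = t\<^sup>2" using pos by simp
  then show ?thesis unfolding lam_def th c_def[symmetric] by simp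
qed

text \<open>The third moment is \<open>c \<kappa> (a b t)^3\<close>; dividing by \<kappa> leaves an
  odd power, which keeps the sign of \<open>t\<close>. The second moment carries the factor
  \<open>1 + c t\<^sup>2\<close> that the square root in the coefficient cancels.\<close>

lemma lda_sign_of_singular_pair:
  assumes \<kappa>: "\<kappa> = \<alpha>1 - \<alpha>2" "\<kappa> \<noteq> 0"
    and "S *v u = a *\<^sub>R x" "R *v v = b *\<^sub>R y" "H *v y = t *\<^sub>R x" "norm x = 1" "norm y = 1" "a > 0" "b > 0"
  shows "lda_sign M X \<alpha>1 \<alpha>2 u v = sgn t"
    and "bilin_moment M X 2 u v = (a * b)\<^sup>2 * (1 + c * t\<^sup>2)"
proof -
  have "u \<bullet> (D *v v) = (S *v u) \<bullet> (H *v (R *v v))"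
    unfolding D_mult by (rule symmetric_mat_inner[OF transpose_mat_sqrt[OF A], symmetric])
  also have "\<dots> = a * b * t"
    using assms(6) by (simp add: assms(3-5) matrix_vector_mult_scaleR norm_eq_1)
  finally have uDv: "u \<bullet> (D *v v) = a * b * t" .
  have "inverse (\<alpha>1 - \<alpha>2) * bilin_moment M X 3 u v = (c * (a * b) ^ 3) * t ^ 3"
    unfolding \<kappa>(1)[symmetric] using \<kappa>(2) by (simp add: bilin_moment_eq uDv power_mult_distrib)
  moreover have "sgn (t ^ 3) = sgn t" by (simp add: sgn_if zero_less_power_eq numeral_3_eq_3 zero_less_mult_iff mult_less_0_iff)
  ultimately show "lda_sign M X \<alpha>1 \<alpha>2 u v = sgn t"
    using assms(8,9) c by (simp add: lda_sign_def sgn_mult)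
  show "bilin_moment M X 2 u v = (a * b)\<^sup>2 * (1 + c * t\<^sup>2)"
    using assms(6,7)
    by (simp add: bilin_moment_eq uDv inner_mat_sqrt[OF A] inner_mat_sqrt[OF B] assms(3,4) power_mult_distrib algebra_simps)
qed

lemma lda_from_ratio_optimizers:
  fixes u :: "nat \<Rightarrow> real^'p" and v :: "nat \<Rightarrow> real^'q" and d :: nat
  assumes c_def: "c = \<alpha>1 * \<alpha>2" and c6: "1 - 6 * c \<noteq> 0" and \<kappa>: "\<kappa> = \<alpha>1 - \<alpha>2" "\<kappa> \<noteq> 0"
    and dist: "distinct_nonzero_singular_values H" and d: "d = rank D"
    and fu: "\<And>j. j \<in> {1..d} \<Longrightarrow> feasible1 M X u v j (u j)" and fv: "\<And>j. j \<in> {1..d} \<Longrightarrow> feasible2 M X u v j (v j)"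
    and maxu: "\<And>j w. j \<in> {1..d} \<Longrightarrow> feasible1 M X u v j w \<Longrightarrow> ratio w \<le> ratio (u j)"
    and maxv: "\<And>j w. j \<in> {1..d} \<Longrightarrow> feasible2 M X u v j w \<Longrightarrow> coratio w \<le> coratio (v j)"
  shows "(\<forall>j\<in>{1..d}. lda_sign M X \<alpha>1 \<alpha>2 (u j) (v j) \<in> {-1, 1}) \<and>
      (\<Sum>j=1..d. (lda_sign M X \<alpha>1 \<alpha>2 (u j) (v j) * lam M X \<alpha>1 \<alpha>2 (u j)
                        * sqrt (1 + \<alpha>1 * \<alpha>2 * (lam M X \<alpha>1 \<alpha>2 (u j))\<^sup>2)
                      / sqrt (bilin_moment M X 2 (u j) (v j))) *\<^sub>R outer_prod (u j) (v j))
      = matrix_inv A ** D ** matrix_inv B"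
proof -
  define a where "a j = norm (S *v u j)" for j
  define b where "b j = norm (R *v v j)" for j
  define x where "x j = (1 / a j) *\<^sub>R (S *v u j)" for j
  define y where "y j = (1 / b j) *\<^sub>R (R *v v j)" for j
  have uv0: "u j \<noteq> 0" "v j \<noteq> 0" if "j \<in> {1..d}" for j
    using fu[OF that] fv[OF that] by (auto simp: feasible1_def feasible2_def)
  have ab: "a j > 0" "b j > 0" if "j \<in> {1..d}" for j
    using norm_S_pos norm_R_pos uv0[OF that] by (simp_all add: a_def b_def)
  have Su: "S *v u j = a j *\<^sub>R x j" and Rv: "R *v v j = b j *\<^sub>R y j"
    and n1: "norm (x j) = 1" "norm (y j) = 1" if "j \<in> {1..d}" for j
    using ab[OF that] by (simp_all add: x_def y_def) (simp_all add: a_def b_def)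
  have sing: "(\<exists>t. t \<noteq> 0 \<and> H *v y j = t *\<^sub>R x j \<and> transpose H *v x j = t *\<^sub>R y j)
    \<and> (\<forall>k\<in>{1..<j}. x j \<bullet> x k = 0 \<and> y j \<bullet> y k = 0)" if "j \<in> {1..d}" for j
    unfolding x_def y_def a_def b_def
  proof (rule ratio_optimizers_singular_pairs[OF dist])
    show "d \<le> rank H" by (simp only: d rank_H)
  qed (fact fu fv maxu maxv that)+
  then have "\<forall>j\<in>{1..d}. \<exists>t. t \<noteq> 0 \<and> H *v y j = t *\<^sub>R x j \<and> transpose H *v x j = t *\<^sub>R y j"
    by blast
  then obtain t where "\<forall>j\<in>{1..d}. t j \<noteq> 0 \<and> H *v y j = t j *\<^sub>R x j \<and> transpose H *v x j = t j *\<^sub>R y j"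
    unfolding bchoice_iff by blast
  then have t: "\<And>j. j \<in> {1..d} \<Longrightarrow> t j \<noteq> 0"
    "\<And>j. j \<in> {1..d} \<Longrightarrow> H *v y j = t j *\<^sub>R x j" "\<And>j. j \<in> {1..d} \<Longrightarrow> transpose H *v x j = t j *\<^sub>R y j"
    by blast+
  have orth: "x k \<bullet> x l = (if k = l then 1 else 0) \<and> y k \<bullet> y l = (if k = l then 1 else 0)"
    if "k \<in> {1..d}" "l \<in> {1..d}" for k l
    using sing[OF that(1)] sing[OF that(2)] n1[OF that(1)] that
    by (cases k l rule: linorder_cases) (auto simp: norm_eq_1 inner_commute)
  have Hsum: "H = (\<Sum>j\<in>{1..d}. t j *\<^sub>R outer_prod (x j) (y j))"
    by (rule matrix_expansion_of_singular_pairs) (use orth t d rank_H in auto)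
  have sgn: "lda_sign M X \<alpha>1 \<alpha>2 (u j) (v j) = sgn (t j)"
    and mom: "bilin_moment M X 2 (u j) (v j) = (a j * b j)\<^sup>2 * (1 + c * (t j)\<^sup>2)"
    and lam: "lam M X \<alpha>1 \<alpha>2 (u j) = \<bar>t j\<bar>" if j: "j \<in> {1..d}" for j
    using lda_sign_of_singular_pair[OF \<kappa> Su[OF j] Rv[OF j] t(2)[OF j] n1[OF j] ab[OF j]]
      lam_of_singular_pair[OF c_def c6 uv0(1)[OF j] Su[OF j] t(3)[OF j] n1[OF j]] by simp_all
  \<comment> \<open>The sign restores \<open>t\<close> from its absolute value, and the two square
    roots leave the weight required by \<open>sum_outer_prod_eq_inv_D_inv\<close>.\<close>
  have coeff: "lda_sign M X \<alpha>1 \<alpha>2 (u j) (v j) * lam M X \<alpha>1 \<alpha>2 (u j)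
        * sqrt (1 + \<alpha>1 * \<alpha>2 * (lam M X \<alpha>1 \<alpha>2 (u j))\<^sup>2) / sqrt (bilin_moment M X 2 (u j) (v j))
      = t j / (a j * b j)" if j: "j \<in> {1..d}" for j
  proof -
    have pos: "1 + c * (t j)\<^sup>2 > 0" using c by (simp add: add_pos_nonneg)
    have "sqrt ((a j * b j)\<^sup>2 * (1 + c * (t j)\<^sup>2)) = (a j * b j) * sqrt (1 + c * (t j)\<^sup>2)"
      using ab[OF j] by (simp add: real_sqrt_mult)
    moreover have "sgn (t j) * \<bar>t j\<bar> = t j" by (simp add: sgn_mult_abs)
    ultimately show ?thesis
      using pos by (simp add: sgn[OF j] mom[OF j] lam[OF j] c_def[symmetric])
  qed
  have "(\<Sum>j=1..d. (lda_sign M X \<alpha>1 \<alpha>2 (u j) (v j) * lam M X \<alpha>1 \<alpha>2 (u j)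
                        * sqrt (1 + \<alpha>1 * \<alpha>2 * (lam M X \<alpha>1 \<alpha>2 (u j))\<^sup>2)
                      / sqrt (bilin_moment M X 2 (u j) (v j))) *\<^sub>R outer_prod (u j) (v j))
     = (\<Sum>j\<in>{1..d}. (t j / (a j * b j)) *\<^sub>R outer_prod (u j) (v j))"
    by (intro sum.cong refl) (simp only: coeff)
  also have "\<dots> = matrix_inv A ** D ** matrix_inv B"
    by (rule sum_outer_prod_eq_inv_D_inv[OF Hsum]) (use Su Rv ab in \<open>auto simp: less_imp_neq[symmetric]\<close>)
  finally show ?thesis using sgn t(1) by (simp add: sgn_if)
qed

end

section \<open>Transposition and the three ranges of the mixing weight\<close>

context normal_mixture
begin

lemma mixture_moments_X: "mixture_moments M X (T2 - T1) A B (\<alpha>1 * \<alpha>2) (\<alpha>1 - \<alpha>2)"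
  using centered_moments \<alpha>1 \<alpha>2 A B by unfold_locales auto

lemma mixture_moments_transpose:
  "mixture_moments M (\<lambda>\<omega>. transpose (X \<omega>)) (transpose (T2 - T1)) B A (\<alpha>1 * \<alpha>2) (\<alpha>1 - \<alpha>2)"
proof unfold_locales
  have flip: "C \<bullet> transpose Z = transpose C \<bullet> Z" for C :: "real^'p^'q" and Z :: "real^'q^'p"
    by (metis inner_transpose transpose_transpose)
  have sand: "C \<bullet> (B ** C ** A) = transpose C \<bullet> (A ** transpose C ** B)" for C :: "real^'p^'q"
  proof -
    have "B ** C ** A = transpose (A ** transpose C ** B)"
      using A B by (simp add: matrix_transpose_mul matrix_mul_assoc)
    then show ?thesis by (simp add: flip)
  qed
  fix C :: "real^'p^'q"
  show "has_bochner_integral M (\<lambda>\<omega>. (C \<bullet> centered M (\<lambda>\<omega>. transpose (X \<omega>)) \<omega>)\<^sup>2)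
      (\<alpha>1 * \<alpha>2 * (C \<bullet> transpose (T2 - T1))\<^sup>2 + C \<bullet> (B ** C ** A))"
    "has_bochner_integral M (\<lambda>\<omega>. (C \<bullet> centered M (\<lambda>\<omega>. transpose (X \<omega>)) \<omega>) ^ 3)
      (\<alpha>1 * \<alpha>2 * (\<alpha>1 - \<alpha>2) * (C \<bullet> transpose (T2 - T1)) ^ 3)"
    "has_bochner_integral M (\<lambda>\<omega>. (C \<bullet> centered M (\<lambda>\<omega>. transpose (X \<omega>)) \<omega>) ^ 4)
      (\<alpha>1 * \<alpha>2 * (1 - 3 * (\<alpha>1 * \<alpha>2)) * (C \<bullet> transpose (T2 - T1)) ^ 4
       + 6 * (\<alpha>1 * \<alpha>2) * (C \<bullet> transpose (T2 - T1))\<^sup>2 * (C \<bullet> (B ** C ** A)) + 3 * (C \<bullet> (B ** C ** A))\<^sup>2)"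
    unfolding centered_transpose flip sand by (rule centered_moments)+
qed (use \<alpha>1 \<alpha>2 A B in auto)

end

theorem theorem2:
  fixes M :: "'a measure" and X :: "'a \<Rightarrow> real^'q^'p"
    and T1 T2 :: "real^'q^'p" and A :: "real^'p^'p" and B :: "real^'q^'q"
    and \<alpha>1 \<alpha>2 :: real and d :: nat
  assumes "prob_space M" and "X \<in> borel_measurable M"
    and "0 < \<alpha>1" and "\<alpha>1 < 1" and "\<alpha>2 = 1 - \<alpha>1"
    and "pos_def_mat A" and "pos_def_mat B" and "T1 \<noteq> T2"
    and "distr M borel X = mixture \<alpha>1 (normal_mat T1 A B) \<alpha>2 (normal_mat T2 A B)"
    and "d = rank (T2 - T1)"
    and "distinct_nonzero_singular_values
           (matrix_inv (mat_sqrt A) ** (T2 - T1) ** matrix_inv (mat_sqrt B))"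
  shows
    "(\<bar>\<alpha>1 - 1/2\<bar> < 1 / sqrt 12 \<and> \<alpha>1 \<noteq> 1/2 \<longrightarrow>
       (\<forall>u v. minimizer_seq M X d (psi M X) (psi M (\<lambda>\<omega>. transpose (X \<omega>))) u v \<longrightarrow>
          (\<forall>j\<in>{1..d}. lda_sign M X \<alpha>1 \<alpha>2 (u j) (v j) \<in> {-1, 1}) \<and>
          (\<Sum>j=1..d. (lda_sign M X \<alpha>1 \<alpha>2 (u j) (v j) * lam M X \<alpha>1 \<alpha>2 (u j)
                        * sqrt (1 + \<alpha>1 * \<alpha>2 * (lam M X \<alpha>1 \<alpha>2 (u j))\<^sup>2)
                      / sqrt (bilin_moment M X 2 (u j) (v j))) *\<^sub>R outer_prod (u j) (v j))
            = W_LDA T1 T2 A B)) \<and>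
     (\<bar>\<alpha>1 - 1/2\<bar> = 1 / sqrt 12 \<longrightarrow>
       (\<forall>u\<in>sphere 0 1. psi M X u = real CARD('q) * (real CARD('q) + 2)) \<and>
       (\<forall>v\<in>sphere 0 1. psi M (\<lambda>\<omega>. transpose (X \<omega>)) v = real CARD('p) * (real CARD('p) + 2))) \<and>
     (\<bar>\<alpha>1 - 1/2\<bar> > 1 / sqrt 12 \<longrightarrow>
       (\<forall>u v. maximizer_seq M X d (psi M X) (psi M (\<lambda>\<omega>. transpose (X \<omega>))) u v \<longrightarrow>
          (\<forall>j\<in>{1..d}. lda_sign M X \<alpha>1 \<alpha>2 (u j) (v j) \<in> {-1, 1}) \<and>
          (\<Sum>j=1..d. (lda_sign M X \<alpha>1 \<alpha>2 (u j) (v j) * lam M X \<alpha>1 \<alpha>2 (u j)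
                        * sqrt (1 + \<alpha>1 * \<alpha>2 * (lam M X \<alpha>1 \<alpha>2 (u j))\<^sup>2)
                      / sqrt (bilin_moment M X 2 (u j) (v j))) *\<^sub>R outer_prod (u j) (v j))
            = W_LDA T1 T2 A B))"
proof -
  interpret N: normal_mixture M X T1 T2 A B \<alpha>1 \<alpha>2
    using assms by (simp add: normal_mixture_def normal_mixture_axioms_def)
  interpret P: mixture_moments M X "T2 - T1" A B "\<alpha>1 * \<alpha>2" "\<alpha>1 - \<alpha>2"
    by (rule N.mixture_moments_X)
  interpret Q: mixture_moments M "\<lambda>\<omega>. transpose (X \<omega>)" "transpose (T2 - T1)" B A "\<alpha>1 * \<alpha>2" "\<alpha>1 - \<alpha>2"
    by (rule N.mixture_moments_transpose)
  let ?c = "\<alpha>1 * \<alpha>2"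
  have c: "?c > 0" using assms by simp
  \<comment> \<open>From \<open>c = 1/4 - (\<alpha>1 - 1/2)\<^sup>2\<close>, so
    \<open>1 - 6c\<close> vanishes exactly when the distance to 1/2 is
    \<open>1 / sqrt 12\<close>.\<close>
  have c6: "1 - 6 * ?c = 6 * ((\<alpha>1 - 1/2)\<^sup>2 - (1 / sqrt 12)\<^sup>2)"
    by (simp add: \<open>\<alpha>2 = 1 - \<alpha>1\<close> power_divide power2_eq_square field_simps)
  have s12: "0 \<le> 1 / sqrt 12" by simp
  \<comment> \<open>The standardized difference of the transposed problem is the transpose of
    \<open>P.H\<close>, so the claims about the second index come from the instance
    \<open>Q\<close>.\<close>
  have coratio: "P.coratio w = Q.ratio w" for w
    by (simp add: P.coratio_def Q.ratio_def matrix_transpose_mul matrix_mul_assoc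
        transpose_matrix_inv_mat_sqrt[OF assms(6)] transpose_matrix_inv_mat_sqrt[OF assms(7)])
  have main: "(\<forall>j\<in>{1..d}. lda_sign M X \<alpha>1 \<alpha>2 (u j) (v j) \<in> {-1, 1}) \<and>
          (\<Sum>j=1..d. (lda_sign M X \<alpha>1 \<alpha>2 (u j) (v j) * lam M X \<alpha>1 \<alpha>2 (u j)
                        * sqrt (1 + \<alpha>1 * \<alpha>2 * (lam M X \<alpha>1 \<alpha>2 (u j))\<^sup>2)
                      / sqrt (bilin_moment M X 2 (u j) (v j))) *\<^sub>R outer_prod (u j) (v j))
            = W_LDA T1 T2 A B"
    if k: "\<alpha>1 \<noteq> 1/2"
      and opt: "?c * (1 - 6 * ?c) < 0 \<and> minimizer_seq M X d (psi M X) (psi M (\<lambda>\<omega>. transpose (X \<omega>))) u v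
      \<or> ?c * (1 - 6 * ?c) > 0 \<and> maximizer_seq M X d (psi M X) (psi M (\<lambda>\<omega>. transpose (X \<omega>))) u v" for u v
    unfolding W_LDA_def
  proof (rule P.lda_from_ratio_optimizers)
    have nz: "feasible1 M X u v j w \<Longrightarrow> w \<noteq> 0" "feasible2 M X u v j w' \<Longrightarrow> w' \<noteq> 0" for j w w'
      by (auto simp: feasible1_def feasible2_def)
    show fu: "feasible1 M X u v j (u j)" and fv: "feasible2 M X u v j (v j)" if "j \<in> {1..d}" for j
      using opt that by (auto simp: minimizer_seq_def maximizer_seq_def is_arg_min_def is_arg_max_def)
    show "P.ratio w \<le> P.ratio (u j)" if "j \<in> {1..d}" "feasible1 M X u v j w" for j w
      using opt that(1)
      by (intro P.ratio_le_of_optimal_psi[OF nz(1)[OF fu[OF that(1)]], of "feasible1 M X u v j"] nz(1) that(2))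
        (auto simp: minimizer_seq_def maximizer_seq_def)
    show "P.coratio w \<le> P.coratio (v j)" if "j \<in> {1..d}" "feasible2 M X u v j w" for j w
      unfolding coratio
      using opt that(1)
      by (intro Q.ratio_le_of_optimal_psi[OF nz(2)[OF fv[OF that(1)]], of "feasible2 M X u v j"] nz(2) that(2))
        (auto simp: minimizer_seq_def maximizer_seq_def)
  qed (use opt k assms in auto)
  have neg: "?c * (1 - 6 * ?c) < 0" if "\<bar>\<alpha>1 - 1/2\<bar> < 1 / sqrt 12"
  proof -
    have "(\<alpha>1 - 1/2)\<^sup>2 < (1 / sqrt 12)\<^sup>2"
      using that power_strict_mono[of "\<bar>\<alpha>1 - 1/2\<bar>" "1 / sqrt 12" 2] by simp
    then have "1 - 6 * ?c < 0" unfolding c6 by simp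
    with c show ?thesis by (rule mult_pos_neg)
  qed
  have zero: "1 - 6 * ?c = 0" if "\<bar>\<alpha>1 - 1/2\<bar> = 1 / sqrt 12"
    unfolding c6 that[symmetric] by simp
  have pos: "?c * (1 - 6 * ?c) > 0" if "\<bar>\<alpha>1 - 1/2\<bar> > 1 / sqrt 12"
  proof -
    have "(1 / sqrt 12)\<^sup>2 < (\<alpha>1 - 1/2)\<^sup>2"
      using that power_strict_mono[of "1 / sqrt 12" "\<bar>\<alpha>1 - 1/2\<bar>" 2] s12 by simp
    then have "1 - 6 * ?c > 0" unfolding c6 by simp
    with c show ?thesis by (rule mult_pos_pos)
  qed
  show ?thesis
  proof (intro conjI[OF _ conjI] impI allI, goal_cases)
    case (1 u v)
    then show ?case using main neg by blast
  next
    case 2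
    have "w \<noteq> 0" if "w \<in> sphere 0 1" for w :: "real^'p" using that by auto
    moreover have "w \<noteq> 0" if "w \<in> sphere 0 1" for w :: "real^'q" using that by auto
    ultimately show ?case using zero[OF 2] by (simp add: P.psi_eq_singular Q.psi_eq_singular)
  next
    case (3 u v)
    \<comment> \<open>Needed for the signs, and automatic in this range since 1/2 has distance 0
      from itself.\<close>
    have "\<alpha>1 \<noteq> 1/2"
    proof
      assume "\<alpha>1 = 1/2"
      with 3(1) have "1 / sqrt 12 < 0" by simp
      with s12 show False by simp
    qed
    with 3 show ?case using main pos by blast
  qed
qed

end
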